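(* Let $\mathbb D$ be an equipment with underlying bicategory $\mathcal D$ (objects, loose arrows and globular cells). If $D:\mathcal I\to\mathcal D$ is a lax functor with a bicategorical colimit cocone $\eta:D\to\Delta c$, then $\eta$ is also a loose colimit cocone for $D$ viewed as a lax double functor $\mathcal I\to\mathbb D$.
   Context: An *equipment* is a pseudo double category in which every loose arrow $n:x'\to y'$ has a restriction $n(f,g):x\to y$ along any tight arrows $f:x\to x'$, $g:y\to y'$ (with its universal cartesian cell). The bicategory $\mathcal I$ is regarded as a double category in the loose direction (only identity tight arrows). $\mathbb L\mathsf{ax}(\mathcal I,\mathbb D)$ is the double category of double functors, strict tight transformations, pseudo loose transformations and modifications, and $\Delta:\mathbb D\to\mathbb L\mathsf{ax}(\mathcal I,\mathbb D)$ is the diagonal. A cocone $\eta:D\to\Delta c$ is a pseudo (loose) transformation. Composing and whiskering with $\eta$ gives a map $t$ taking loose arrows $m:c\to d$ to pseudo loose transformations $tm:D\to\Delta d$, and cells to modifications. The cocone $\eta$ is a *bicategorical colimit cocone* in $\mathcal D$ if for every object $d$, $t$ is an equivalence from $\mathcal D(c,d)$ to the category of pseudo transformations $D\to\Delta d$ and (globular) modifications. The cocone $\eta$ is a *loose colimit cocone* in $\mathbb D$ if the map of loose bimodules $\mathbb D(c,-)\to\mathbb L\mathsf{ax}(\mathcal I,\mathbb D)(D,\Delta-)$ given by $t$ is an equivalence, i.e. equivalently: (1) every pseudo loose transformation $D\to\Delta d$ is isomorphic, via a globular modification, to some $tm$; (2) for all loose arrows $m:c\to d$, $n:c\to d'$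 and tight $f:d\to d'$, $t$ induces a bijection between cells from $m$ to $n$ with left boundary $1_c$ and right boundary $f$, and modifications from $tm$ to $tn$ with left boundary $1_D$ and right boundary $\Delta f$. *)

theory Defs
  imports "HOL-Library.FuncSet"
begin

section \<open>Categories and equivalences of categories\<close>

record ('o, 'a) cat =
  Ob   :: "'o set"
  Ar   :: "'a set"
  Dom  :: "'a \<Rightarrow> 'o"
  Cod  :: "'a \<Rightarrow> 'o"
  ide  :: "'o \<Rightarrow> 'a"
  Comp :: "'a \<Rightarrow> 'a \<Rightarrow> 'a"

definition hom :: "('o, 'a) cat \<Rightarrow> 'o \<Rightarrow> 'o \<Rightarrow> 'a set" where
  "hom C x y = {f \<in> Ar C. Dom C f = x \<and> Cod C f = y}"

locale category =
  fixes C :: "('o, 'a) cat"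
  assumes dom_ob: "f \<in> Ar C \<Longrightarrow> Dom C f \<in> Ob C"
    and cod_ob: "f \<in> Ar C \<Longrightarrow> Cod C f \<in> Ob C"
    and ide_hom: "x \<in> Ob C \<Longrightarrow> ide C x \<in> hom C x x"
    and comp_hom: "\<lbrakk>f \<in> hom C x y; g \<in> hom C y z\<rbrakk> \<Longrightarrow> Comp C g f \<in> hom C x z"
    and comp_ide_left: "f \<in> hom C x y \<Longrightarrow> Comp C (ide C y) f = f"
    and comp_ide_right: "f \<in> hom C x y \<Longrightarrow> Comp C f (ide C x) = f"
    and comp_assoc: "\<lbrakk>f \<in> hom C w x; g \<in> hom C x y; h \<in> hom C y z\<rbrakk>
      \<Longrightarrow> Comp C (Comp C h g) f = Comp C h (Comp C g f)"

definition inverse_in :: "('o, 'a) cat \<Rightarrow> 'a \<Rightarrow> 'a \<Rightarrow> bool" where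
  "inverse_in C f g \<longleftrightarrow> f \<in> Ar C \<and> g \<in> hom C (Cod C f) (Dom C f)
     \<and> Comp C g f = ide C (Dom C f) \<and> Comp C f g = ide C (Cod C f)"

definition iso_in :: "('o, 'a) cat \<Rightarrow> 'a \<Rightarrow> bool" where
  "iso_in C f \<longleftrightarrow> (\<exists>g. inverse_in C f g)"

definition inv_in :: "('o, 'a) cat \<Rightarrow> 'a \<Rightarrow> 'a" where
  "inv_in C f = (THE g. inverse_in C f g)"

definition isomorphic_in :: "('o, 'a) cat \<Rightarrow> 'o \<Rightarrow> 'o \<Rightarrow> bool" where
  "isomorphic_in C x y \<longleftrightarrow> (\<exists>f \<in> hom C x y. iso_in C f)"

locale cat_functor =
  fixes A :: "('o, 'a) cat" and B :: "('p, 'b) cat" and Fo :: "'o \<Rightarrow> 'p" and Fa :: "'a \<Rightarrow> 'b"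
  assumes ob: "x \<in> Ob A \<Longrightarrow> Fo x \<in> Ob B"
    and ar: "f \<in> hom A x y \<Longrightarrow> Fa f \<in> hom B (Fo x) (Fo y)"
    and pres_ide: "x \<in> Ob A \<Longrightarrow> Fa (ide A x) = ide B (Fo x)"
    and pres_comp: "\<lbrakk>f \<in> hom A x y; g \<in> hom A y z\<rbrakk>
      \<Longrightarrow> Fa (Comp A g f) = Comp B (Fa g) (Fa f)"

locale natural_iso =
  fixes A :: "('o, 'a) cat" and B :: "('p, 'b) cat"
    and Fo :: "'o \<Rightarrow> 'p" and Fa :: "'a \<Rightarrow> 'b" and Go :: "'o \<Rightarrow> 'p" and Ga :: "'a \<Rightarrow> 'b"
    and \<phi> :: "'o \<Rightarrow> 'b"
  assumes component: "x \<in> Ob A \<Longrightarrow> \<phi> x \<in> hom B (Fo x) (Go x) \<and> iso_in B (\<phi> x)"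
    and natural: "f \<in> hom A x y \<Longrightarrow> Comp B (Ga f) (\<phi> x) = Comp B (\<phi> y) (Fa f)"

definition equivalence_of_categories ::
    "('o, 'a) cat \<Rightarrow> ('p, 'b) cat \<Rightarrow> ('o \<Rightarrow> 'p) \<Rightarrow> ('a \<Rightarrow> 'b) \<Rightarrow> bool" where
  "equivalence_of_categories A B Fo Fa \<longleftrightarrow> cat_functor A B Fo Fa \<and>
     (\<exists>Go Ga \<phi> \<psi>. cat_functor B A Go Ga
        \<and> natural_iso A A id id (Go \<circ> Fo) (Ga \<circ> Fa) \<phi>
        \<and> natural_iso B B (Fo \<circ> Go) (Fa \<circ> Ga) id id \<psi>)"

section \<open>Pseudo double categories\<close>

text \<open>
  A pseudo double category is a pseudo category object in categories.  \<open>Tight\<close> is the category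
  of objects and tight arrows, \<open>Cells\<close> the category of loose arrows and cells under tight
  composition.  Compositions are written in applicative order: \<open>n \<odot> m\<close> and \<open>b \<star> a\<close>
  are the loose composites, with \<open>m\<close> and \<open>a\<close> on the left, and \<open>b \<bullet> a\<close> is the tight
  composite, with \<open>a\<close> on top.  \<open>unitl\<close> and \<open>unitc\<close> give the loose identities on objects and
  on tight arrows; \<open>assoc\<close>, \<open>lunit\<close>, \<open>runit\<close> are the associators \<open>(p \<odot> n) \<odot> m \<rightarrow> p \<odot> (n \<odot> m)\<close>
  and the unitors \<open>1 \<odot> m \<rightarrow> m\<close>, \<open>m \<odot> 1 \<rightarrow> m\<close>.
\<close>

record ('o, 't, 'l, 'c) dblcat =
  Tight :: "('o, 't) cat"
  Cells :: "('l, 'c) cat"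
  lsrc  :: "'l \<Rightarrow> 'o"
  ltgt  :: "'l \<Rightarrow> 'o"
  left  :: "'c \<Rightarrow> 't"
  right :: "'c \<Rightarrow> 't"
  unitl :: "'o \<Rightarrow> 'l"
  unitc :: "'t \<Rightarrow> 'c"
  lcomp :: "'l \<Rightarrow> 'l \<Rightarrow> 'l"  (infixl "\<odot>\<index>" 75)
  hcomp :: "'c \<Rightarrow> 'c \<Rightarrow> 'c"  (infixl "\<star>\<index>" 70)
  assoc :: "'l \<Rightarrow> 'l \<Rightarrow> 'l \<Rightarrow> 'c"
  lunit :: "'l \<Rightarrow> 'c"
  runit :: "'l \<Rightarrow> 'c"

abbreviation vcomp ::
    "('o, 't, 'l, 'c) dblcat \<Rightarrow> 'c \<Rightarrow> 'c \<Rightarrow> 'c"  (infixl "\<bullet>\<index>" 65) where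
  "vcomp X b a \<equiv> Comp (Cells X) b a"

abbreviation tid :: "('o, 't, 'l, 'c) dblcat \<Rightarrow> 'o \<Rightarrow> 't" where
  "tid X x \<equiv> ide (Tight X) x"

abbreviation cid :: "('o, 't, 'l, 'c) dblcat \<Rightarrow> 'l \<Rightarrow> 'c" where
  "cid X m \<equiv> ide (Cells X) m"

definition loose :: "('o, 't, 'l, 'c) dblcat \<Rightarrow> 'o \<Rightarrow> 'o \<Rightarrow> 'l set" where
  "loose X x y = {m \<in> Ob (Cells X). lsrc X m = x \<and> ltgt X m = y}"

definition cells :: "('o, 't, 'l, 'c) dblcat \<Rightarrow> 'l \<Rightarrow> 'l \<Rightarrow> 't \<Rightarrow> 't \<Rightarrow> 'c set" where
  "cells X m n f g = {a \<in> hom (Cells X) m n. left X a = f \<and> right X a = g}"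

definition globular :: "('o, 't, 'l, 'c) dblcat \<Rightarrow> 'l \<Rightarrow> 'l \<Rightarrow> 'c set" where
  "globular X m n = cells X m n (tid X (lsrc X m)) (tid X (ltgt X m))"

locale pseudo_double_category =
  fixes X :: "('o, 't, 'l, 'c) dblcat" (structure)
  assumes tight_cat: "category (Tight X)"
    and cells_cat: "category (Cells X)"
    and source_functor: "cat_functor (Cells X) (Tight X) (lsrc X) (left X)"
    and target_functor: "cat_functor (Cells X) (Tight X) (ltgt X) (right X)"
    and unit_functor: "cat_functor (Tight X) (Cells X) (unitl X) (unitc X)"
    and unitl_loose: "x \<in> Ob (Tight X) \<Longrightarrow> unitl X x \<in> loose X x x"
    and unitc_boundary: "f \<in> Ar (Tight X) \<Longrightarrow> left X (unitc X f) = f \<and> right X (unitc X f) = f"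
    and lcomp_loose: "\<lbrakk>m \<in> loose X x y; n \<in> loose X y z\<rbrakk> \<Longrightarrow> n \<odot> m \<in> loose X x z"
    and hcomp_cells: "\<lbrakk>a \<in> cells X m m' f g; b \<in> cells X n n' g h\<rbrakk>
      \<Longrightarrow> b \<star> a \<in> cells X (n \<odot> m) (n' \<odot> m') f h"
    and hcomp_ide: "\<lbrakk>m \<in> loose X x y; n \<in> loose X y z\<rbrakk>
      \<Longrightarrow> cid X n \<star> cid X m = cid X (n \<odot> m)"
    and interchange:
      "\<lbrakk>a \<in> cells X m m' f g; b \<in> cells X n n' g h;
        a' \<in> cells X m' m'' f' g'; b' \<in> cells X n' n'' g' h'\<rbrakk>
      \<Longrightarrow> (b' \<bullet> b) \<star> (a' \<bullet> a) = (b' \<star> a') \<bullet> (b \<star> a)"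
    and assoc_iso: "\<lbrakk>m \<in> loose X w x; n \<in> loose X x y; p \<in> loose X y z\<rbrakk>
      \<Longrightarrow> assoc X p n m \<in> globular X (p \<odot> n \<odot> m) (p \<odot> (n \<odot> m))
          \<and> iso_in (Cells X) (assoc X p n m)"
    and assoc_natural:
      "\<lbrakk>a \<in> cells X m m' f g; b \<in> cells X n n' g h; e \<in> cells X p p' h k\<rbrakk>
      \<Longrightarrow> assoc X p' n' m' \<bullet> (e \<star> b \<star> a) = (e \<star> (b \<star> a)) \<bullet> assoc X p n m"
    and lunit_iso: "m \<in> loose X x y
      \<Longrightarrow> lunit X m \<in> globular X (unitl X y \<odot> m) m \<and> iso_in (Cells X) (lunit X m)"
    and lunit_natural: "a \<in> cells X m m' f g
      \<Longrightarrow> lunit X m' \<bullet> (unitc X g \<star> a) = a \<bullet> lunit X m"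
    and runit_iso: "m \<in> loose X x y
      \<Longrightarrow> runit X m \<in> globular X (m \<odot> unitl X x) m \<and> iso_in (Cells X) (runit X m)"
    and runit_natural: "a \<in> cells X m m' f g
      \<Longrightarrow> runit X m' \<bullet> (a \<star> unitc X f) = a \<bullet> runit X m"
    and triangle: "\<lbrakk>m \<in> loose X x y; n \<in> loose X y z\<rbrakk>
      \<Longrightarrow> (cid X n \<star> lunit X m) \<bullet> assoc X n (unitl X y) m = runit X n \<star> cid X m"
    and pentagon:
      "\<lbrakk>m \<in> loose X v w; n \<in> loose X w x; p \<in> loose X x y; q \<in> loose X y z\<rbrakk>
      \<Longrightarrow> assoc X q p (n \<odot> m) \<bullet> assoc X (q \<odot> p) n m
        = (cid X q \<star> assoc X p n m) \<bullet> assoc X q (p \<odot> n) m \<bullet> (assoc X q p n \<star> cid X m)"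

text \<open>
  A cell \<open>\<kappa>\<close> is cartesian if every cell with the same bottom whose side boundaries factor
  through those of \<open>\<kappa>\<close> factors uniquely through \<open>\<kappa>\<close> with the prescribed sides; its top is then
  the restriction of its bottom along its sides.
\<close>

definition cartesian :: "('o, 't, 'l, 'c) dblcat \<Rightarrow> 'c \<Rightarrow> bool" where
  "cartesian X \<kappa> \<longleftrightarrow> \<kappa> \<in> Ar (Cells X) \<and>
    (\<forall>h \<in> Ar (Tight X). \<forall>k \<in> Ar (Tight X). \<forall>m \<in> Ob (Cells X).
       Cod (Tight X) h = Dom (Tight X) (left X \<kappa>) \<longrightarrow>
       Cod (Tight X) k = Dom (Tight X) (right X \<kappa>) \<longrightarrow>
       (\<forall>a \<in> cells X m (Cod (Cells X) \<kappa>)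
               (Comp (Tight X) (left X \<kappa>) h) (Comp (Tight X) (right X \<kappa>) k).
          \<exists>!b. b \<in> cells X m (Dom (Cells X) \<kappa>) h k \<and> vcomp X \<kappa> b = a))"

locale equipment = pseudo_double_category +
  assumes restriction:
    "\<lbrakk>n \<in> loose X x' y'; f \<in> hom (Tight X) x x'; g \<in> hom (Tight X) y y'\<rbrakk>
     \<Longrightarrow> \<exists>r \<in> loose X x y. \<exists>\<kappa> \<in> cells X r n f g. cartesian X \<kappa>"

text \<open>
  A bicategory is regarded as a double category in the loose direction: its only tight arrows
  are identities, so all its cells are globular.
\<close>

locale bicategory = pseudo_double_category +
  assumes tight_identities: "Ar (Tight X) = tid X ` Ob (Tight X)"

definition underlying_bicategory ::
    "('o, 't, 'l, 'c) dblcat \<Rightarrow> ('o, 't, 'l, 'c) dblcat" where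
  "underlying_bicategory X = X
     \<lparr>Tight := (Tight X)\<lparr>Ar := tid X ` Ob (Tight X)\<rparr>,
      Cells := (Cells X)\<lparr>Ar := {a \<in> Ar (Cells X). left X a \<in> tid X ` Ob (Tight X)
                                              \<and> right X a \<in> tid X ` Ob (Tight X)}\<rparr>\<rparr>"

text \<open>The category of loose arrows \<open>x \<rightarrow> y\<close> and globular cells between them.\<close>

definition loose_hom_cat :: "('o, 't, 'l, 'c) dblcat \<Rightarrow> 'o \<Rightarrow> 'o \<Rightarrow> ('l, 'c) cat" where
  "loose_hom_cat X x y =
     \<lparr>Ob = loose X x y,
      Ar = {a \<in> Ar (Cells X). left X a = tid X x \<and> right X a = tid X y},
      Dom = Dom (Cells X), Cod = Cod (Cells X), ide = ide (Cells X), Comp = Comp (Cells X)\<rparr>"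

section \<open>Lax double functors\<close>

record ('io, 'it, 'il, 'ic, 'o, 't, 'l, 'c) dblfunctor =
  FO :: "'io \<Rightarrow> 'o"
  FT :: "'it \<Rightarrow> 't"
  FL :: "'il \<Rightarrow> 'l"
  FC :: "'ic \<Rightarrow> 'c"
  Fcomp :: "'il \<Rightarrow> 'il \<Rightarrow> 'c"
  Funit :: "'io \<Rightarrow> 'c"

text \<open>
  The laxity cells are \<open>Fcomp F v u : F v \<odot> F u \<rightarrow> F (v \<odot> u)\<close> and \<open>Funit F i : 1 \<rightarrow> F 1\<close>.
  A lax functor between bicategories is a lax double functor between them.
\<close>

locale lax_double_functor =
  fixes I :: "('io, 'it, 'il, 'ic) dblcat" and X :: "('o, 't, 'l, 'c) dblcat" (structure)
    and F :: "('io, 'it, 'il, 'ic, 'o, 't, 'l, 'c) dblfunctor"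
  assumes tight_functor: "cat_functor (Tight I) (Tight X) (FO F) (FT F)"
    and cells_functor: "cat_functor (Cells I) (Cells X) (FL F) (FC F)"
    and loose: "u \<in> loose I i j \<Longrightarrow> FL F u \<in> loose X (FO F i) (FO F j)"
    and boundary: "a \<in> Ar (Cells I)
      \<Longrightarrow> left X (FC F a) = FT F (left I a) \<and> right X (FC F a) = FT F (right I a)"
    and Fcomp_cell: "\<lbrakk>u \<in> loose I i j; v \<in> loose I j k\<rbrakk>
      \<Longrightarrow> Fcomp F v u \<in> globular X (FL F v \<odot> FL F u) (FL F (v \<odot>\<^bsub>I\<^esub> u))"
    and Fcomp_natural: "\<lbrakk>a \<in> cells I u u' f g; b \<in> cells I v v' g h\<rbrakk>
      \<Longrightarrow> FC F (b \<star>\<^bsub>I\<^esub> a) \<bullet> Fcomp F v u = Fcomp F v' u' \<bullet> (FC F b \<star> FC F a)"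
    and Funit_cell: "i \<in> Ob (Tight I)
      \<Longrightarrow> Funit F i \<in> globular X (unitl X (FO F i)) (FL F (unitl I i))"
    and Funit_natural: "f \<in> hom (Tight I) i j
      \<Longrightarrow> FC F (unitc I f) \<bullet> Funit F i = Funit F j \<bullet> unitc X (FT F f)"
    and Fcomp_assoc: "\<lbrakk>u \<in> loose I i j; v \<in> loose I j k; w \<in> loose I k l\<rbrakk>
      \<Longrightarrow> FC F (assoc I w v u) \<bullet> Fcomp F (w \<odot>\<^bsub>I\<^esub> v) u \<bullet> (Fcomp F w v \<star> cid X (FL F u))
        = Fcomp F w (v \<odot>\<^bsub>I\<^esub> u) \<bullet> (cid X (FL F w) \<star> Fcomp F v u)
            \<bullet> assoc X (FL F w) (FL F v) (FL F u)"
    and Fcomp_lunit: "u \<in> loose I i j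
      \<Longrightarrow> FC F (lunit I u) \<bullet> Fcomp F (unitl I j) u \<bullet> (Funit F j \<star> cid X (FL F u))
        = lunit X (FL F u)"
    and Fcomp_runit: "u \<in> loose I i j
      \<Longrightarrow> FC F (runit I u) \<bullet> Fcomp F u (unitl I i) \<bullet> (cid X (FL F u) \<star> Funit F i)
        = runit X (FL F u)"

definition const_functor ::
    "('o, 't, 'l, 'c) dblcat \<Rightarrow> 'o \<Rightarrow> ('io, 'it, 'il, 'ic, 'o, 't, 'l, 'c) dblfunctor" where
  "const_functor X d =
     \<lparr>FO = (\<lambda>_. d), FT = (\<lambda>_. tid X d), FL = (\<lambda>_. unitl X d), FC = (\<lambda>_. cid X (unitl X d)),
      Fcomp = (\<lambda>_ _. lunit X (unitl X d)), Funit = (\<lambda>_. cid X (unitl X d))\<rparr>"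

section \<open>Tight and loose transformations, modifications\<close>

record ('io, 'il, 't, 'c) tight_trans =
  VO :: "'io \<Rightarrow> 't"
  VL :: "'il \<Rightarrow> 'c"

locale strict_tight_trans =
  fixes I :: "('io, 'it, 'il, 'ic) dblcat" and X :: "('o, 't, 'l, 'c) dblcat" (structure)
    and F G :: "('io, 'it, 'il, 'ic, 'o, 't, 'l, 'c) dblfunctor"
    and \<alpha> :: "('io, 'il, 't, 'c) tight_trans"
  assumes component: "i \<in> Ob (Tight I) \<Longrightarrow> VO \<alpha> i \<in> hom (Tight X) (FO F i) (FO G i)"
    and component_loose: "u \<in> loose I i j
      \<Longrightarrow> VL \<alpha> u \<in> cells X (FL F u) (FL G u) (VO \<alpha> i) (VO \<alpha> j)"
    and natural: "f \<in> hom (Tight I) i j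
      \<Longrightarrow> Comp (Tight X) (FT G f) (VO \<alpha> i) = Comp (Tight X) (VO \<alpha> j) (FT F f)"
    and natural_cells: "a \<in> hom (Cells I) u v \<Longrightarrow> FC G a \<bullet> VL \<alpha> u = VL \<alpha> v \<bullet> FC F a"
    and comp: "\<lbrakk>u \<in> loose I i j; v \<in> loose I j k\<rbrakk>
      \<Longrightarrow> VL \<alpha> (v \<odot>\<^bsub>I\<^esub> u) \<bullet> Fcomp F v u = Fcomp G v u \<bullet> (VL \<alpha> v \<star> VL \<alpha> u)"
    and unit: "i \<in> Ob (Tight I)
      \<Longrightarrow> VL \<alpha> (unitl I i) \<bullet> Funit F i = Funit G i \<bullet> unitc X (VO \<alpha> i)"

definition id_tight_trans ::
    "('o, 't, 'l, 'c) dblcat \<Rightarrow> ('io, 'it, 'il, 'ic, 'o, 't, 'l, 'c) dblfunctor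
     \<Rightarrow> ('io, 'il, 't, 'c) tight_trans" where
  "id_tight_trans X F = \<lparr>VO = (\<lambda>i. tid X (FO F i)), VL = (\<lambda>u. cid X (FL F u))\<rparr>"

definition const_tight_trans ::
    "('o, 't, 'l, 'c) dblcat \<Rightarrow> 't \<Rightarrow> ('io, 'il, 't, 'c) tight_trans" where
  "const_tight_trans X f = \<lparr>VO = (\<lambda>_. f), VL = (\<lambda>_. unitc X f)\<rparr>"

lemma id_tight_trans_strict:
  assumes I: "pseudo_double_category I" and X: "pseudo_double_category X"
    and F: "lax_double_functor I X F"
  shows "strict_tight_trans I X F F (id_tight_trans X F)"
proof -
  interpret I: pseudo_double_category I by fact
  interpret X: pseudo_double_category X by fact
  interpret F: lax_double_functor I X F by fact
  interpret T: category "Tight X" by (rule X.tight_cat)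
  interpret V: category "Cells X" by (rule X.cells_cat)
  interpret S: cat_functor "Cells X" "Tight X" "lsrc X" "left X" by (rule X.source_functor)
  interpret R: cat_functor "Cells X" "Tight X" "ltgt X" "right X" by (rule X.target_functor)
  interpret FT: cat_functor "Tight I" "Tight X" "FO F" "FT F" by (rule F.tight_functor)
  interpret FC: cat_functor "Cells I" "Cells X" "FL F" "FC F" by (rule F.cells_functor)
  interpret U: cat_functor "Tight X" "Cells X" "unitl X" "unitc X" by (rule X.unit_functor)
  have glob_hom: "a \<in> globular X m n \<Longrightarrow> a \<in> hom (Cells X) m n" for a m n
    by (simp add: globular_def cells_def)
  show ?thesis
  proof
    fix i assume i: "i \<in> Ob (Tight I)"
    show "VO (id_tight_trans X F) i \<in> hom (Tight X) (FO F i) (FO F i)"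
      using i FT.ob T.ide_hom by (simp add: id_tight_trans_def)
    show "Comp (Cells X) (VL (id_tight_trans X F) (unitl I i)) (Funit F i)
        = Comp (Cells X) (Funit F i) (unitc X (VO (id_tight_trans X F) i))"
      using V.comp_ide_left[OF glob_hom[OF F.Funit_cell[OF i]]]
        V.comp_ide_right[OF glob_hom[OF F.Funit_cell[OF i]]] U.pres_ide[OF FT.ob[OF i]]
      by (simp add: id_tight_trans_def)
  next
    fix u i j assume u: "u \<in> loose I i j"
    then have "FL F u \<in> loose X (FO F i) (FO F j)" by (rule F.loose)
    then show "VL (id_tight_trans X F) u
        \<in> cells X (FL F u) (FL F u) (VO (id_tight_trans X F) i) (VO (id_tight_trans X F) j)"
      using V.ide_hom S.pres_ide R.pres_ide
      by (auto simp: id_tight_trans_def cells_def loose_def)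
  next
    fix f i j assume "f \<in> hom (Tight I) i j"
    then show "Comp (Tight X) (FT F f) (VO (id_tight_trans X F) i)
        = Comp (Tight X) (VO (id_tight_trans X F) j) (FT F f)"
      using FT.ar T.comp_ide_left T.comp_ide_right by (metis id_tight_trans_def tight_trans.select_convs(1))
  next
    fix a u v assume "a \<in> hom (Cells I) u v"
    then show "Comp (Cells X) (FC F a) (VL (id_tight_trans X F) u)
        = Comp (Cells X) (VL (id_tight_trans X F) v) (FC F a)"
      using FC.ar V.comp_ide_left V.comp_ide_right by (metis id_tight_trans_def tight_trans.select_convs(2))
  next
    fix u i j v k assume u: "u \<in> loose I i j" and v: "v \<in> loose I j k"
    note c = glob_hom[OF F.Fcomp_cell[OF u v]]
    show "Comp (Cells X) (VL (id_tight_trans X F) (v \<odot>\<^bsub>I\<^esub> u)) (Fcomp F v u)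
        = Comp (Cells X) (Fcomp F v u) (VL (id_tight_trans X F) v \<star>\<^bsub>X\<^esub> VL (id_tight_trans X F) u)"
      using V.comp_ide_left[OF c] V.comp_ide_right[OF c] X.hcomp_ide[OF F.loose[OF u] F.loose[OF v]]
      by (simp add: id_tight_trans_def)
  qed
qed

lemma const_tight_trans_strict:
  assumes I: "pseudo_double_category I" and X: "pseudo_double_category X"
    and f: "f \<in> hom (Tight X) d d'"
  shows "strict_tight_trans I X (const_functor X d) (const_functor X d') (const_tight_trans X f)"
proof -
  interpret X: pseudo_double_category X by fact
  interpret T: category "Tight X" by (rule X.tight_cat)
  interpret V: category "Cells X" by (rule X.cells_cat)
  interpret U: cat_functor "Tight X" "Cells X" "unitl X" "unitc X" by (rule X.unit_functor)
  have u: "unitc X f \<in> hom (Cells X) (unitl X d) (unitl X d')" by (rule U.ar[OF f])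
  have c: "unitc X f \<in> cells X (unitl X d) (unitl X d') f f"
    using u X.unitc_boundary f by (auto simp: cells_def hom_def)
  show ?thesis
    using f c T.comp_ide_left[OF f] T.comp_ide_right[OF f] V.comp_ide_left[OF u]
      V.comp_ide_right[OF u] X.lunit_natural[OF c]
    by unfold_locales (auto simp: const_functor_def const_tight_trans_def)
qed

record ('io, 'it, 'il, 'l, 'c) loose_trans =
  TO :: "'io \<Rightarrow> 'l"
  TT :: "'it \<Rightarrow> 'c"
  TL :: "'il \<Rightarrow> 'c"

text \<open>
  The component of a pseudo loose transformation \<open>\<sigma> : F \<rightarrow> G\<close> at a loose arrow \<open>u : i \<rightarrow> j\<close> is an
  invertible globular cell \<open>\<sigma> j \<odot> F u \<rightarrow> G u \<odot> \<sigma> i\<close>.  The components are extensional so that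
  equality of transformations is equality of their components on \<open>I\<close>.
\<close>

locale pseudo_loose_trans =
  fixes I :: "('io, 'it, 'il, 'ic) dblcat" and X :: "('o, 't, 'l, 'c) dblcat" (structure)
    and F G :: "('io, 'it, 'il, 'ic, 'o, 't, 'l, 'c) dblfunctor"
    and \<sigma> :: "('io, 'it, 'il, 'l, 'c) loose_trans"
  assumes extensional: "TO \<sigma> \<in> extensional (Ob (Tight I))"
      "TT \<sigma> \<in> extensional (Ar (Tight I))" "TL \<sigma> \<in> extensional (Ob (Cells I))"
    and tight_functor: "cat_functor (Tight I) (Cells X) (TO \<sigma>) (TT \<sigma>)"
    and component: "i \<in> Ob (Tight I) \<Longrightarrow> TO \<sigma> i \<in> loose X (FO F i) (FO G i)"
    and component_tight: "f \<in> Ar (Tight I)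
      \<Longrightarrow> left X (TT \<sigma> f) = FT F f \<and> right X (TT \<sigma> f) = FT G f"
    and component_loose: "u \<in> loose I i j
      \<Longrightarrow> TL \<sigma> u \<in> globular X (TO \<sigma> j \<odot> FL F u) (FL G u \<odot> TO \<sigma> i)
          \<and> iso_in (Cells X) (TL \<sigma> u)"
    and natural_cells: "a \<in> cells I u v f g
      \<Longrightarrow> (FC G a \<star> TT \<sigma> f) \<bullet> TL \<sigma> u = TL \<sigma> v \<bullet> (TT \<sigma> g \<star> FC F a)"
    and comp: "\<lbrakk>u \<in> loose I i j; v \<in> loose I j k\<rbrakk>
      \<Longrightarrow> TL \<sigma> (v \<odot>\<^bsub>I\<^esub> u) \<bullet> (cid X (TO \<sigma> k) \<star> Fcomp F v u)
        = (Fcomp G v u \<star> cid X (TO \<sigma> i))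
            \<bullet> inv_in (Cells X) (assoc X (FL G v) (FL G u) (TO \<sigma> i))
            \<bullet> (cid X (FL G v) \<star> TL \<sigma> u)
            \<bullet> assoc X (FL G v) (TO \<sigma> j) (FL F u)
            \<bullet> (TL \<sigma> v \<star> cid X (FL F u))
            \<bullet> inv_in (Cells X) (assoc X (TO \<sigma> k) (FL F v) (FL F u))"
    and unit: "i \<in> Ob (Tight I)
      \<Longrightarrow> TL \<sigma> (unitl I i) \<bullet> (cid X (TO \<sigma> i) \<star> Funit F i)
        = (Funit G i \<star> cid X (TO \<sigma> i)) \<bullet> inv_in (Cells X) (lunit X (TO \<sigma> i))
            \<bullet> runit X (TO \<sigma> i)"

text \<open>
  A modification has strict tight transformations \<open>\<alpha>\<close>, \<open>\<beta>\<close> as left and right boundary and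
  pseudo loose transformations \<open>\<sigma>\<close>, \<open>\<tau>\<close> as top and bottom boundary.
\<close>

locale modification =
  fixes I :: "('io, 'it, 'il, 'ic) dblcat" and X :: "('o, 't, 'l, 'c) dblcat" (structure)
    and \<alpha> \<beta> :: "('io, 'il, 't, 'c) tight_trans"
    and \<sigma> \<tau> :: "('io, 'it, 'il, 'l, 'c) loose_trans"
    and \<mu> :: "'io \<Rightarrow> 'c"
  assumes extensional: "\<mu> \<in> extensional (Ob (Tight I))"
    and component: "i \<in> Ob (Tight I)
      \<Longrightarrow> \<mu> i \<in> cells X (TO \<sigma> i) (TO \<tau> i) (VO \<alpha> i) (VO \<beta> i)"
    and tight: "f \<in> hom (Tight I) i j \<Longrightarrow> TT \<tau> f \<bullet> \<mu> i = \<mu> j \<bullet> TT \<sigma> f"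
    and loose: "u \<in> loose I i j
      \<Longrightarrow> (VL \<beta> u \<star> \<mu> i) \<bullet> TL \<sigma> u = TL \<tau> u \<bullet> (\<mu> j \<star> VL \<alpha> u)"

text \<open>
  The category of pseudo loose transformations \<open>F \<rightarrow> G\<close> and globular modifications; an arrow is a
  modification together with its domain and codomain.
\<close>

definition trans_cat ::
    "('io, 'it, 'il, 'ic) dblcat \<Rightarrow> ('o, 't, 'l, 'c) dblcat
     \<Rightarrow> ('io, 'it, 'il, 'ic, 'o, 't, 'l, 'c) dblfunctor
     \<Rightarrow> ('io, 'it, 'il, 'ic, 'o, 't, 'l, 'c) dblfunctor
     \<Rightarrow> (('io, 'it, 'il, 'l, 'c) loose_trans,
         ('io, 'it, 'il, 'l, 'c) loose_trans \<times> ('io \<Rightarrow> 'c)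
           \<times> ('io, 'it, 'il, 'l, 'c) loose_trans) cat" where
  "trans_cat I X F G =
     \<lparr>Ob = {\<sigma>. pseudo_loose_trans I X F G \<sigma>},
      Ar = {(\<sigma>, \<mu>, \<tau>). pseudo_loose_trans I X F G \<sigma> \<and> pseudo_loose_trans I X F G \<tau>
              \<and> modification I X (id_tight_trans X F) (id_tight_trans X G) \<sigma> \<tau> \<mu>},
      Dom = (\<lambda>(\<sigma>, \<mu>, \<tau>). \<sigma>), Cod = (\<lambda>(\<sigma>, \<mu>, \<tau>). \<tau>),
      ide = (\<lambda>\<sigma>. (\<sigma>, \<lambda>i\<in>Ob (Tight I). cid X (TO \<sigma> i), \<sigma>)),
      Comp = (\<lambda>(\<sigma>', \<nu>, \<tau>') (\<sigma>, \<mu>, \<tau>). (\<sigma>, \<lambda>i\<in>Ob (Tight I). vcomp X (\<nu> i) (\<mu> i), \<tau>'))\<rparr>"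

text \<open>
  The loose composite of \<open>\<sigma> : F \<rightarrow> G\<close> and \<open>\<tau> : G \<rightarrow> H\<close>; its component at \<open>u : i \<rightarrow> j\<close> is
  \<open>(\<tau> j \<odot> \<sigma> j) \<odot> F u \<cong> \<tau> j \<odot> (\<sigma> j \<odot> F u) \<rightarrow> \<tau> j \<odot> (G u \<odot> \<sigma> i) \<cong> (\<tau> j \<odot> G u) \<odot> \<sigma> i
  \<rightarrow> (H u \<odot> \<tau> i) \<odot> \<sigma> i \<cong> H u \<odot> (\<tau> i \<odot> \<sigma> i)\<close>.
\<close>

definition trans_comp ::
    "('io, 'it, 'il, 'ic) dblcat \<Rightarrow> ('o, 't, 'l, 'c) dblcat
     \<Rightarrow> ('io, 'it, 'il, 'ic, 'o, 't, 'l, 'c) dblfunctor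
     \<Rightarrow> ('io, 'it, 'il, 'ic, 'o, 't, 'l, 'c) dblfunctor
     \<Rightarrow> ('io, 'it, 'il, 'ic, 'o, 't, 'l, 'c) dblfunctor
     \<Rightarrow> ('io, 'it, 'il, 'l, 'c) loose_trans \<Rightarrow> ('io, 'it, 'il, 'l, 'c) loose_trans
     \<Rightarrow> ('io, 'it, 'il, 'l, 'c) loose_trans" where
  "trans_comp I X F G H \<tau> \<sigma> =
     \<lparr>TO = (\<lambda>i\<in>Ob (Tight I). TO \<tau> i \<odot>\<^bsub>X\<^esub> TO \<sigma> i),
      TT = (\<lambda>f\<in>Ar (Tight I). TT \<tau> f \<star>\<^bsub>X\<^esub> TT \<sigma> f),
      TL = (\<lambda>u\<in>Ob (Cells I). let i = lsrc I u; j = ltgt I u in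
              assoc X (FL H u) (TO \<tau> i) (TO \<sigma> i)
              \<bullet>\<^bsub>X\<^esub> (TL \<tau> u \<star>\<^bsub>X\<^esub> cid X (TO \<sigma> i))
              \<bullet>\<^bsub>X\<^esub> inv_in (Cells X) (assoc X (TO \<tau> j) (FL G u) (TO \<sigma> i))
              \<bullet>\<^bsub>X\<^esub> (cid X (TO \<tau> j) \<star>\<^bsub>X\<^esub> TL \<sigma> u)
              \<bullet>\<^bsub>X\<^esub> assoc X (TO \<tau> j) (TO \<sigma> j) (FL F u))\<rparr>"

text \<open>The diagonal on a loose arrow \<open>m : c \<rightarrow> d\<close>: the transformation \<open>\<Delta>c \<rightarrow> \<Delta>d\<close>.\<close>

definition const_loose_trans ::
    "('io, 'it, 'il, 'ic) dblcat \<Rightarrow> ('o, 't, 'l, 'c) dblcat \<Rightarrow> 'l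
     \<Rightarrow> ('io, 'it, 'il, 'l, 'c) loose_trans" where
  "const_loose_trans I X m =
     \<lparr>TO = (\<lambda>i\<in>Ob (Tight I). m),
      TT = (\<lambda>f\<in>Ar (Tight I). cid X m),
      TL = (\<lambda>u\<in>Ob (Cells I). inv_in (Cells X) (lunit X m) \<bullet>\<^bsub>X\<^esub> runit X m)\<rparr>"

section \<open>Colimit cocones\<close>

text \<open>
  The map \<open>t\<close> of composition and whiskering with a cocone \<open>\<eta> : D \<rightarrow> \<Delta>c\<close>:
  \<open>t m = \<Delta>m \<odot> \<eta>\<close> on loose arrows out of \<open>c\<close>, and \<open>t a = \<Delta>a \<star> 1\<close> on cells.
\<close>

definition cocone_map ::
    "('io, 'it, 'il, 'ic) dblcat \<Rightarrow> ('o, 't, 'l, 'c) dblcat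
     \<Rightarrow> ('io, 'it, 'il, 'ic, 'o, 't, 'l, 'c) dblfunctor
     \<Rightarrow> ('io, 'it, 'il, 'l, 'c) loose_trans \<Rightarrow> 'l \<Rightarrow> ('io, 'it, 'il, 'l, 'c) loose_trans" where
  "cocone_map I X D \<eta> m =
     trans_comp I X D (const_functor X (lsrc X m)) (const_functor X (ltgt X m))
       (const_loose_trans I X m) \<eta>"

definition cocone_map_cell ::
    "('io, 'it, 'il, 'ic) dblcat \<Rightarrow> ('o, 't, 'l, 'c) dblcat
     \<Rightarrow> ('io, 'it, 'il, 'l, 'c) loose_trans \<Rightarrow> 'c \<Rightarrow> 'io \<Rightarrow> 'c" where
  "cocone_map_cell I X \<eta> a = (\<lambda>i\<in>Ob (Tight I). a \<star>\<^bsub>X\<^esub> cid X (TO \<eta> i))"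

definition bicategorical_colimit_cocone ::
    "('io, 'it, 'il, 'ic) dblcat \<Rightarrow> ('o, 't, 'l, 'c) dblcat
     \<Rightarrow> ('io, 'it, 'il, 'ic, 'o, 't, 'l, 'c) dblfunctor
     \<Rightarrow> 'o \<Rightarrow> ('io, 'it, 'il, 'l, 'c) loose_trans \<Rightarrow> bool" where
  "bicategorical_colimit_cocone I B D c \<eta> \<longleftrightarrow>
     c \<in> Ob (Tight B) \<and> pseudo_loose_trans I B D (const_functor B c) \<eta> \<and>
     (\<forall>d \<in> Ob (Tight B).
        equivalence_of_categories (loose_hom_cat B c d) (trans_cat I B D (const_functor B d))
          (cocone_map I B D \<eta>)
          (\<lambda>a. (cocone_map I B D \<eta> (Dom (Cells B) a), cocone_map_cell I B \<eta> a,
                cocone_map I B D \<eta> (Cod (Cells B) a))))"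

definition loose_colimit_cocone ::
    "('io, 'it, 'il, 'ic) dblcat \<Rightarrow> ('o, 't, 'l, 'c) dblcat
     \<Rightarrow> ('io, 'it, 'il, 'ic, 'o, 't, 'l, 'c) dblfunctor
     \<Rightarrow> 'o \<Rightarrow> ('io, 'it, 'il, 'l, 'c) loose_trans \<Rightarrow> bool" where
  "loose_colimit_cocone I X D c \<eta> \<longleftrightarrow>
     c \<in> Ob (Tight X) \<and> pseudo_loose_trans I X D (const_functor X c) \<eta> \<and>
     (\<forall>d \<in> Ob (Tight X). \<forall>\<sigma>. pseudo_loose_trans I X D (const_functor X d) \<sigma> \<longrightarrow>
        (\<exists>m \<in> loose X c d.
           isomorphic_in (trans_cat I X D (const_functor X d)) \<sigma> (cocone_map I X D \<eta> m))) \<and>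
     (\<forall>d \<in> Ob (Tight X). \<forall>d' \<in> Ob (Tight X). \<forall>m \<in> loose X c d. \<forall>n \<in> loose X c d'.
        \<forall>f \<in> hom (Tight X) d d'.
          bij_betw (cocone_map_cell I X \<eta>)
            (cells X m n (tid X c) f)
            {\<mu>. modification I X (id_tight_trans X D) (const_tight_trans X f)
                  (cocone_map I X D \<eta> m) (cocone_map I X D \<eta> n) \<mu>})"

end

theory Submission
  imports Defs
begin

text \<open>
  Essential surjectivity of \<open>t\<close> concerns only globular modifications, so it is literally the
  essential surjectivity of the bicategorical statement.  The content is the passage from
  globular cells to cells \<open>m \<rightarrow> n\<close> with a tight arrow \<open>f : d \<rightarrow> d'\<close> on the right, and here the
  equipment enters: such a cell is the same thing as a globular cell from \<open>m\<close> to the restriction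
  \<open>r = n(1, f)\<close>, by composition with the cartesian cell \<open>\<kappa> : r \<rightarrow> n\<close>.  The bicategorical
  colimit property identifies these globular cells with globular modifications
  \<open>t m \<rightarrow> t r\<close>.  It remains to see that composition with \<open>t \<kappa>\<close> identifies the latter with
  modifications \<open>t m \<rightarrow> t n\<close> that have \<open>\<Delta>f\<close> on the right (\<open>loose_cocone_bij\<close>).

  The components of \<open>t \<kappa>\<close> are the whiskered cells \<open>\<kappa> \<star> 1\<close> along the legs of the cocone, so this
  needs that they are cartesian again.  That is not formal for an arbitrary cartesian cell of a
  double category, but restrictions along the target are composites: if \<open>f' : d' \<rightarrow> d\<close> is the
  conjoint of \<open>f\<close>, that is the restriction of the loose identity of \<open>d'\<close> along \<open>(1, f)\<close>, then
  \<open>f' \<odot> n\<close> restricts \<open>n\<close>, and associativity turns the restriction of \<open>n \<odot> p\<close> into the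
  restriction of \<open>n\<close> whiskered with \<open>p\<close> (\<open>restriction_stable\<close>).  The conjoint comes with a cell
  \<open>\<theta> : 1 \<rightarrow> f'\<close>, and pasting with \<open>\<theta>\<close> inverts composition with the cartesian cell; the identities
  behind this use the unit coherence laws \<open>lunit_lcomp\<close> and \<open>lunit_eq_runit\<close>.

  Given a modification \<open>\<mu> : t m \<rightarrow> t n\<close>, its components therefore factor uniquely through
  \<open>t \<kappa>\<close>.  The factors form a modification because the two sides of the modification
  equation agree after composition with a cell that is monic on globular cells
  (\<open>modification_factors\<close>).

  Finally everything about \<open>trans_cat\<close> and \<open>t\<close> has to be compared between the equipment and its
  underlying bicategory.  The cells involved are globular, and the inverse of a globular
  cell is globular, so the two readings agree.
\<close>

section \<open>Isomorphisms and equivalences of categories\<close>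

text \<open>
  The category axioms with typing conditions on domains and codomains instead of membership in
  hom-sets, so that the simplifier can discharge them by rewriting.
\<close>

lemma (in category) arr_simps:
  "\<lbrakk>f \<in> Ar C; g \<in> Ar C; Cod C f = Dom C g\<rbrakk> \<Longrightarrow> Comp C g f \<in> Ar C"
  "\<lbrakk>f \<in> Ar C; g \<in> Ar C; Cod C f = Dom C g\<rbrakk> \<Longrightarrow> Dom C (Comp C g f) = Dom C f"
  "\<lbrakk>f \<in> Ar C; g \<in> Ar C; Cod C f = Dom C g\<rbrakk> \<Longrightarrow> Cod C (Comp C g f) = Cod C g"
  "x \<in> Ob C \<Longrightarrow> ide C x \<in> Ar C"
  "x \<in> Ob C \<Longrightarrow> Dom C (ide C x) = x"
  "x \<in> Ob C \<Longrightarrow> Cod C (ide C x) = x"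
  "\<lbrakk>f \<in> Ar C; Cod C f = x\<rbrakk> \<Longrightarrow> Comp C (ide C x) f = f"
  "\<lbrakk>f \<in> Ar C; Dom C f = x\<rbrakk> \<Longrightarrow> Comp C f (ide C x) = f"
  "\<lbrakk>f \<in> Ar C; g \<in> Ar C; h \<in> Ar C; Cod C f = Dom C g; Cod C g = Dom C h\<rbrakk>
    \<Longrightarrow> Comp C (Comp C h g) f = Comp C h (Comp C g f)"
  using comp_hom[of f "Dom C f" "Cod C f" g "Cod C g"] ide_hom[of x]
    comp_ide_left[of f] comp_ide_right[of f] comp_assoc[of f _ _ g _ h]
  by (auto simp: hom_def)

lemma inverse_in_sym: "inverse_in C f g \<Longrightarrow> inverse_in C g f"
  by (auto simp: inverse_in_def hom_def)

context category
begin

lemma inverse_in_unique: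
  assumes "inverse_in C f g" and "inverse_in C f h"
  shows "g = h"
proof -
  have "Comp C (Comp C g f) h = Comp C g (Comp C f h)"
    using assms by (intro arr_simps(9)) (auto simp: inverse_in_def hom_def)
  then show ?thesis
    using assms by (simp add: inverse_in_def hom_def arr_simps)
qed

lemma inv_in_eqI: "inverse_in C f g \<Longrightarrow> inv_in C f = g"
  unfolding inv_in_def using inverse_in_unique by blast

lemma inverse_in_inv_in: "iso_in C f \<Longrightarrow> inverse_in C f (inv_in C f)"
  unfolding iso_in_def using inv_in_eqI by blast

lemma inv_in_simps:
  assumes "iso_in C f"
  shows "f \<in> Ar C" "inv_in C f \<in> Ar C" "Dom C (inv_in C f) = Cod C f" "Cod C (inv_in C f) = Dom C f"
    "Comp C (inv_in C f) f = ide C (Dom C f)" "Comp C f (inv_in C f) = ide C (Cod C f)"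
    "\<lbrakk>g \<in> Ar C; Cod C g = Dom C f\<rbrakk> \<Longrightarrow> Comp C (inv_in C f) (Comp C f g) = g"
    "\<lbrakk>g \<in> Ar C; Cod C g = Cod C f\<rbrakk> \<Longrightarrow> Comp C f (Comp C (inv_in C f) g) = g"
proof -
  have *: "inverse_in C f (inv_in C f)" by (rule inverse_in_inv_in[OF assms])
  show "f \<in> Ar C" "inv_in C f \<in> Ar C" "Dom C (inv_in C f) = Cod C f" "Cod C (inv_in C f) = Dom C f"
    "Comp C (inv_in C f) f = ide C (Dom C f)" "Comp C f (inv_in C f) = ide C (Cod C f)"
    using * by (auto simp: inverse_in_def hom_def)
  have arr: "f \<in> Ar C" "inv_in C f \<in> Ar C" "Dom C (inv_in C f) = Cod C f" "Cod C (inv_in C f) = Dom C f"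
    and inv: "Comp C (inv_in C f) f = ide C (Dom C f)" "Comp C f (inv_in C f) = ide C (Cod C f)"
    using * by (auto simp: inverse_in_def hom_def)
  show "Comp C (inv_in C f) (Comp C f g) = g" if "g \<in> Ar C" "Cod C g = Dom C f"
    using arr_simps(9)[of g f "inv_in C f"] arr inv(1) that by (simp add: arr_simps(7))
  show "Comp C f (Comp C (inv_in C f) g) = g" if "g \<in> Ar C" "Cod C g = Cod C f"
    using arr_simps(9)[of g "inv_in C f" f] arr inv(2) that by (simp add: arr_simps(7))
qed

lemma iso_cancel_left:
  assumes k: "iso_in C k" and f: "f \<in> Ar C" "Cod C f = Dom C k" and g: "g \<in> Ar C" "Cod C g = Dom C k"
    and eq: "Comp C k f = Comp C k g"
  shows "f = g"
  using inv_in_simps(7)[OF k f] inv_in_simps(7)[OF k g] unfolding eq by (rule trans[OF sym])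

lemma iso_cancel_right:
  assumes k: "iso_in C k" and f: "f \<in> Ar C" "Dom C f = Cod C k" and g: "g \<in> Ar C" "Dom C g = Cod C k"
    and eq: "Comp C f k = Comp C g k"
  shows "f = g"
proof -
  note i = inv_in_simps(1-6)[OF k]
  have "Comp C (Comp C h k) (inv_in C k) = h" if "h \<in> Ar C" "Dom C h = Cod C k" for h
    using i that arr_simps(9)[of "inv_in C k" k h] by (simp add: arr_simps(8))
  from this[OF f] this[OF g] show ?thesis unfolding eq by (rule trans[OF sym])
qed

end

lemma equivalence_ess_surj:
  assumes "equivalence_of_categories A B Fo Fa" and "y \<in> Ob B"
  shows "\<exists>x \<in> Ob A. isomorphic_in B y (Fo x)"
proof -
  obtain Go Ga \<phi> \<psi> where G: "cat_functor B A Go Ga"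
    and \<psi>: "natural_iso B B (Fo \<circ> Go) (Fa \<circ> Ga) id id \<psi>"
    using assms(1) unfolding equivalence_of_categories_def by blast
  have "\<psi> y \<in> hom B (Fo (Go y)) y" "iso_in B (\<psi> y)"
    using natural_iso.component[OF \<psi> assms(2)] by auto
  then obtain k where "inverse_in B (\<psi> y) k" "Dom B (\<psi> y) = Fo (Go y)" "Cod B (\<psi> y) = y"
    by (auto simp: iso_in_def hom_def)
  then have "k \<in> hom B y (Fo (Go y))" "iso_in B k"
    using inverse_in_sym[of B "\<psi> y" k] by (auto simp: inverse_in_def iso_in_def)
  then show ?thesis
    using cat_functor.ob[OF G assms(2)] unfolding isomorphic_in_def by blast
qed

text \<open>
  Naturality of the unit makes the quasi-inverse a left inverse on hom-sets up to conjugation,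
  hence faithfulness; with naturality of the counit the conjugate by the unit of the image of
  an arrow under the quasi-inverse is a preimage of that arrow.
\<close>

lemma equivalence_fully_faithful:
  assumes A: "category A" and B: "category B" and eq: "equivalence_of_categories A B Fo Fa"
    and x: "x \<in> Ob A" and y: "y \<in> Ob A"
  shows "bij_betw Fa (hom A x y) (hom B (Fo x) (Fo y))"
proof -
  interpret A: category A by fact
  interpret B: category B by fact
  interpret F: cat_functor A B Fo Fa
    using eq unfolding equivalence_of_categories_def by blast
  obtain Go Ga \<phi> \<psi> where G: "cat_functor B A Go Ga"
    and \<phi>: "natural_iso A A id id (Go \<circ> Fo) (Ga \<circ> Fa) \<phi>"
    and \<psi>: "natural_iso B B (Fo \<circ> Go) (Fa \<circ> Ga) id id \<psi>"
    using eq unfolding equivalence_of_categories_def by blast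
  interpret G: cat_functor B A Go Ga by fact
  have \<phi>i: "iso_in A (\<phi> z)" "\<phi> z \<in> Ar A" "Dom A (\<phi> z) = z" "Cod A (\<phi> z) = Go (Fo z)"
    if "z \<in> Ob A" for z
    using natural_iso.component[OF \<phi> that] by (auto simp: hom_def)
  have \<psi>i: "iso_in B (\<psi> z)" "\<psi> z \<in> Ar B" "Dom B (\<psi> z) = Fo (Go z)" "Cod B (\<psi> z) = z"
    if "z \<in> Ob B" for z
    using natural_iso.component[OF \<psi> that] by (auto simp: hom_def)
  have inj: "inj_on Fa (hom A x y)"
  proof (rule inj_onI)
    fix a b assume ab: "a \<in> hom A x y" "b \<in> hom A x y" and eq: "Fa a = Fa b"
    have *: "Comp A (Ga (Fa e)) (\<phi> x) = Comp A (\<phi> y) e" if "e \<in> hom A x y" for e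
      using natural_iso.natural[OF \<phi> that] by simp
    have "Comp A (\<phi> y) a = Comp A (\<phi> y) b"
      using *[OF ab(1)] *[OF ab(2)] unfolding eq by metis
    then show "a = b"
      using ab \<phi>i[OF y] by - (rule A.iso_cancel_left[of "\<phi> y"], simp_all add: hom_def)
  qed
  have "\<exists>a \<in> hom A x y. Fa a = g" if g: "g \<in> hom B (Fo x) (Fo y)" for g
  proof
    have Gg: "Ga g \<in> hom A (Go (Fo x)) (Go (Fo y))" by (rule G.ar[OF g])
    define a where "a = Comp A (inv_in A (\<phi> y)) (Comp A (Ga g) (\<phi> x))"
    show a: "a \<in> hom A x y"
      using Gg \<phi>i[OF x] \<phi>i[OF y] by (auto simp: a_def hom_def A.arr_simps A.inv_in_simps)
    then have Fa: "Fa a \<in> hom B (Fo x) (Fo y)" by (rule F.ar)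
    have "Comp A (Ga (Fa a)) (\<phi> x) = Comp A (Ga g) (\<phi> x)"
      using natural_iso.natural[OF \<phi> a] Gg \<phi>i[OF x] \<phi>i[OF y]
      by (simp add: a_def hom_def A.arr_simps A.inv_in_simps)
    then have GF: "Ga (Fa a) = Ga g"
      using Gg G.ar[OF Fa] \<phi>i[OF x] by - (rule A.iso_cancel_right[of "\<phi> x"], simp_all add: hom_def)
    have "Comp B (Fa a) (\<psi> (Fo x)) = Comp B g (\<psi> (Fo x))"
      using natural_iso.natural[OF \<psi> Fa] natural_iso.natural[OF \<psi> g] GF by simp
    then show "Fa a = g"
      using Fa g \<psi>i[OF F.ob[OF x]] by - (rule B.iso_cancel_right[of "\<psi> (Fo x)"], simp_all add: hom_def)
  qed
  then have "hom B (Fo x) (Fo y) \<subseteq> Fa ` hom A x y"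
    by blast
  moreover have "Fa ` hom A x y \<subseteq> hom B (Fo x) (Fo y)"
    using F.ar by blast
  ultimately show ?thesis using inj unfolding bij_betw_def by blast
qed

section \<open>Calculus of cells in a pseudo double category\<close>

context pseudo_double_category
begin

sublocale T: category "Tight X" by (rule tight_cat)
sublocale V: category "Cells X" by (rule cells_cat)
sublocale S: cat_functor "Cells X" "Tight X" "lsrc X" "left X" by (rule source_functor)
sublocale R: cat_functor "Cells X" "Tight X" "ltgt X" "right X" by (rule target_functor)
sublocale U: cat_functor "Tight X" "Cells X" "unitl X" "unitc X" by (rule unit_functor)

abbreviation arr where "arr a \<equiv> a \<in> Ar (Cells X)"
abbreviation ctop where "ctop a \<equiv> Dom (Cells X) a"
abbreviation cbot where "cbot a \<equiv> Cod (Cells X) a"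
abbreviation loose_arr where "loose_arr m \<equiv> m \<in> Ob (Cells X)"

lemma cellsD:
  assumes "a \<in> cells X m n f g"
  shows "arr a" "ctop a = m" "cbot a = n" "left X a = f" "right X a = g"
  using assms by (auto simp: cells_def hom_def)

lemma cellsI:
  "\<lbrakk>arr a; ctop a = m; cbot a = n; left X a = f; right X a = g\<rbrakk> \<Longrightarrow> a \<in> cells X m n f g"
  by (auto simp: cells_def hom_def)

lemma unitl_simps:
  assumes "x \<in> Ob (Tight X)"
  shows "loose_arr (unitl X x)" "lsrc X (unitl X x) = x" "ltgt X (unitl X x) = x"
  using unitl_loose[OF assms] by (auto simp: loose_def)

lemma loose_simps:
  "loose_arr m \<Longrightarrow> lsrc X m \<in> Ob (Tight X)"
  "loose_arr m \<Longrightarrow> ltgt X m \<in> Ob (Tight X)"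
  "\<lbrakk>loose_arr m; loose_arr n; ltgt X m = lsrc X n\<rbrakk> \<Longrightarrow> loose_arr (n \<odot> m)"
  "\<lbrakk>loose_arr m; loose_arr n; ltgt X m = lsrc X n\<rbrakk> \<Longrightarrow> lsrc X (n \<odot> m) = lsrc X m"
  "\<lbrakk>loose_arr m; loose_arr n; ltgt X m = lsrc X n\<rbrakk> \<Longrightarrow> ltgt X (n \<odot> m) = ltgt X n"
  using S.ob R.ob lcomp_loose[of m "lsrc X m" "ltgt X m" n "ltgt X n"] by (auto simp: loose_def)

text \<open>
  Functoriality of source and target as rewrite rules: the end points of the side boundaries of
  a cell are always reduced to the end points of its top and bottom.
\<close>

lemma cell_simps:
  "arr a \<Longrightarrow> loose_arr (ctop a)"
  "arr a \<Longrightarrow> loose_arr (cbot a)"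
  "arr a \<Longrightarrow> left X a \<in> Ar (Tight X)"
  "arr a \<Longrightarrow> right X a \<in> Ar (Tight X)"
  "arr a \<Longrightarrow> Dom (Tight X) (left X a) = lsrc X (ctop a)"
  "arr a \<Longrightarrow> Cod (Tight X) (left X a) = lsrc X (cbot a)"
  "arr a \<Longrightarrow> Dom (Tight X) (right X a) = ltgt X (ctop a)"
  "arr a \<Longrightarrow> Cod (Tight X) (right X a) = ltgt X (cbot a)"
  "loose_arr m \<Longrightarrow> left X (cid X m) = tid X (lsrc X m)"
  "loose_arr m \<Longrightarrow> right X (cid X m) = tid X (ltgt X m)"
  "\<lbrakk>arr a; arr b; cbot a = ctop b\<rbrakk> \<Longrightarrow> left X (b \<bullet> a) = Comp (Tight X) (left X b) (left X a)"
  "\<lbrakk>arr a; arr b; cbot a = ctop b\<rbrakk> \<Longrightarrow> right X (b \<bullet> a) = Comp (Tight X) (right X b) (right X a)"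
  using S.ar[of a "ctop a" "cbot a"] R.ar[of a "ctop a" "cbot a"] V.dom_ob V.cod_ob
    S.pres_ide R.pres_ide S.pres_comp[of a "ctop a" "cbot a" b "cbot b"]
    R.pres_comp[of a "ctop a" "cbot a" b "cbot b"]
  by (auto simp: hom_def)

lemma hcomp_simps:
  "\<lbrakk>arr a; arr b; right X a = left X b\<rbrakk> \<Longrightarrow> arr (b \<star> a)"
  "\<lbrakk>arr a; arr b; right X a = left X b\<rbrakk> \<Longrightarrow> ctop (b \<star> a) = ctop b \<odot> ctop a"
  "\<lbrakk>arr a; arr b; right X a = left X b\<rbrakk> \<Longrightarrow> cbot (b \<star> a) = cbot b \<odot> cbot a"
  "\<lbrakk>arr a; arr b; right X a = left X b\<rbrakk> \<Longrightarrow> left X (b \<star> a) = left X a"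
  "\<lbrakk>arr a; arr b; right X a = left X b\<rbrakk> \<Longrightarrow> right X (b \<star> a) = right X b"
  "\<lbrakk>loose_arr m; loose_arr n; ltgt X m = lsrc X n\<rbrakk> \<Longrightarrow> cid X n \<star> cid X m = cid X (n \<odot> m)"
  using hcomp_cells[of a "ctop a" "cbot a" "left X a" "right X a" b "ctop b" "cbot b" "right X b"]
    hcomp_ide[of m _ _ n]
  by (auto simp: cells_def hom_def loose_def)

lemma unitc_simps:
  assumes "f \<in> Ar (Tight X)"
  shows "arr (unitc X f)" "ctop (unitc X f) = unitl X (Dom (Tight X) f)"
    "cbot (unitc X f) = unitl X (Cod (Tight X) f)" "left X (unitc X f) = f" "right X (unitc X f) = f"
  using U.ar[of f] unitc_boundary[OF assms] assms by (auto simp: hom_def)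

lemma unitc_tid: "x \<in> Ob (Tight X) \<Longrightarrow> unitc X (tid X x) = cid X (unitl X x)"
  by (rule U.pres_ide)

text \<open>
  The side boundaries of an inverse are inverse to the side boundaries, since taking sides is
  functorial; so invertible globular cells have globular inverses.
\<close>

lemma inv_boundary:
  assumes "iso_in (Cells X) a"
  shows "left X a = tid X x \<Longrightarrow> x = lsrc X (ctop a) \<Longrightarrow> left X (inv_in (Cells X) a) = tid X x"
    and "right X a = tid X y \<Longrightarrow> y = ltgt X (ctop a) \<Longrightarrow> right X (inv_in (Cells X) a) = tid X y"
proof -
  note i = V.inv_in_simps[OF assms]
  have l: "Comp (Tight X) (left X (inv_in (Cells X) a)) (left X a) = tid X (lsrc X (ctop a))"
    using cell_simps(11)[of a "inv_in (Cells X) a"] i by (simp add: cell_simps)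
  show "left X (inv_in (Cells X) a) = tid X x" if "left X a = tid X x" "x = lsrc X (ctop a)"
  proof -
    have "lsrc X (cbot a) = x"
      using cell_simps(6)[OF i(1)] i(1) that by (simp add: T.arr_simps loose_simps cell_simps)
    then show ?thesis using l i that cell_simps(3,5)[OF i(2)] by (simp add: T.arr_simps)
  qed
  have r: "Comp (Tight X) (right X (inv_in (Cells X) a)) (right X a) = tid X (ltgt X (ctop a))"
    using cell_simps(12)[of a "inv_in (Cells X) a"] i by (simp add: cell_simps)
  show "right X (inv_in (Cells X) a) = tid X y" if "right X a = tid X y" "y = ltgt X (ctop a)"
  proof -
    have "ltgt X (cbot a) = y"
      using cell_simps(8)[OF i(1)] i(1) that by (simp add: T.arr_simps loose_simps cell_simps)
    then show ?thesis using r i that cell_simps(4,7)[OF i(2)] by (simp add: T.arr_simps)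
  qed
qed

abbreviation ainv where "ainv p n m \<equiv> inv_in (Cells X) (assoc X p n m)"
abbreviation linv where "linv m \<equiv> inv_in (Cells X) (lunit X m)"
abbreviation rinv where "rinv m \<equiv> inv_in (Cells X) (runit X m)"

lemma assoc_simps:
  assumes m: "loose_arr m" and n: "loose_arr n" and p: "loose_arr p" and mn: "ltgt X m = lsrc X n" and np: "ltgt X n = lsrc X p"
  shows "iso_in (Cells X) (assoc X p n m)"
    "arr (assoc X p n m)" "ctop (assoc X p n m) = p \<odot> n \<odot> m" "cbot (assoc X p n m) = p \<odot> (n \<odot> m)"
    "left X (assoc X p n m) = tid X (lsrc X m)" "right X (assoc X p n m) = tid X (ltgt X p)"
    "arr (ainv p n m)" "ctop (ainv p n m) = p \<odot> (n \<odot> m)" "cbot (ainv p n m) = p \<odot> n \<odot> m"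
    "left X (ainv p n m) = tid X (lsrc X m)" "right X (ainv p n m) = tid X (ltgt X p)"
    "ainv p n m \<bullet> assoc X p n m = cid X (p \<odot> n \<odot> m)"
    "assoc X p n m \<bullet> ainv p n m = cid X (p \<odot> (n \<odot> m))"
    "\<lbrakk>arr a; cbot a = p \<odot> n \<odot> m\<rbrakk> \<Longrightarrow> ainv p n m \<bullet> (assoc X p n m \<bullet> a) = a"
    "\<lbrakk>arr a; cbot a = p \<odot> (n \<odot> m)\<rbrakk> \<Longrightarrow> assoc X p n m \<bullet> (ainv p n m \<bullet> a) = a"
proof -
  have *: "assoc X p n m \<in> globular X (p \<odot> n \<odot> m) (p \<odot> (n \<odot> m))" and i: "iso_in (Cells X) (assoc X p n m)"
    using assoc_iso[of m "lsrc X m" "lsrc X n" n "lsrc X p" p "ltgt X p"] assms by (auto simp: loose_def)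
  show "iso_in (Cells X) (assoc X p n m)" by (rule i)
  show t: "arr (assoc X p n m)" "ctop (assoc X p n m) = p \<odot> n \<odot> m" "cbot (assoc X p n m) = p \<odot> (n \<odot> m)"
    "left X (assoc X p n m) = tid X (lsrc X m)" "right X (assoc X p n m) = tid X (ltgt X p)"
    using * assms by (auto simp: globular_def cells_def hom_def loose_simps)
  note k = V.inv_in_simps[OF i]
  show "arr (ainv p n m)" "ctop (ainv p n m) = p \<odot> (n \<odot> m)" "cbot (ainv p n m) = p \<odot> n \<odot> m"
    "ainv p n m \<bullet> assoc X p n m = cid X (p \<odot> n \<odot> m)"
    "assoc X p n m \<bullet> ainv p n m = cid X (p \<odot> (n \<odot> m))"
    "\<lbrakk>arr a; cbot a = p \<odot> n \<odot> m\<rbrakk> \<Longrightarrow> ainv p n m \<bullet> (assoc X p n m \<bullet> a) = a"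
    "\<lbrakk>arr a; cbot a = p \<odot> (n \<odot> m)\<rbrakk> \<Longrightarrow> assoc X p n m \<bullet> (ainv p n m \<bullet> a) = a"
    using k t by simp_all
  show "left X (ainv p n m) = tid X (lsrc X m)" "right X (ainv p n m) = tid X (ltgt X p)"
    using assms by (auto intro!: inv_boundary[OF i] simp: t loose_simps)
qed

lemma lunit_simps:
  assumes m: "loose_arr m"
  shows "iso_in (Cells X) (lunit X m)"
    "arr (lunit X m)" "ctop (lunit X m) = unitl X (ltgt X m) \<odot> m" "cbot (lunit X m) = m"
    "left X (lunit X m) = tid X (lsrc X m)" "right X (lunit X m) = tid X (ltgt X m)"
    "arr (linv m)" "ctop (linv m) = m" "cbot (linv m) = unitl X (ltgt X m) \<odot> m"
    "left X (linv m) = tid X (lsrc X m)" "right X (linv m) = tid X (ltgt X m)"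
    "linv m \<bullet> lunit X m = cid X (unitl X (ltgt X m) \<odot> m)" "lunit X m \<bullet> linv m = cid X m"
    "\<lbrakk>arr a; cbot a = m\<rbrakk> \<Longrightarrow> lunit X m \<bullet> (linv m \<bullet> a) = a"
proof -
  have *: "lunit X m \<in> globular X (unitl X (ltgt X m) \<odot> m) m" and i: "iso_in (Cells X) (lunit X m)"
    using lunit_iso[of m "lsrc X m" "ltgt X m"] m by (auto simp: loose_def)
  show "iso_in (Cells X) (lunit X m)" by (rule i)
  show t: "arr (lunit X m)" "ctop (lunit X m) = unitl X (ltgt X m) \<odot> m" "cbot (lunit X m) = m"
    "left X (lunit X m) = tid X (lsrc X m)" "right X (lunit X m) = tid X (ltgt X m)"
    using * m by (auto simp: globular_def cells_def hom_def loose_simps unitl_simps)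
  note k = V.inv_in_simps[OF i]
  show "arr (linv m)" "ctop (linv m) = m" "cbot (linv m) = unitl X (ltgt X m) \<odot> m"
    "linv m \<bullet> lunit X m = cid X (unitl X (ltgt X m) \<odot> m)" "lunit X m \<bullet> linv m = cid X m"
    "\<lbrakk>arr a; cbot a = m\<rbrakk> \<Longrightarrow> lunit X m \<bullet> (linv m \<bullet> a) = a"
    using k t by simp_all
  show "left X (linv m) = tid X (lsrc X m)" "right X (linv m) = tid X (ltgt X m)"
    using m by (auto intro!: inv_boundary[OF i] simp: t loose_simps unitl_simps)
qed

lemma runit_simps:
  assumes m: "loose_arr m"
  shows "iso_in (Cells X) (runit X m)"
    "arr (runit X m)" "ctop (runit X m) = m \<odot> unitl X (lsrc X m)" "cbot (runit X m) = m"
    "left X (runit X m) = tid X (lsrc X m)" "right X (runit X m) = tid X (ltgt X m)"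
    "arr (rinv m)" "ctop (rinv m) = m" "cbot (rinv m) = m \<odot> unitl X (lsrc X m)"
    "left X (rinv m) = tid X (lsrc X m)" "right X (rinv m) = tid X (ltgt X m)"
    "rinv m \<bullet> runit X m = cid X (m \<odot> unitl X (lsrc X m))" "runit X m \<bullet> rinv m = cid X m"
proof -
  have *: "runit X m \<in> globular X (m \<odot> unitl X (lsrc X m)) m" and i: "iso_in (Cells X) (runit X m)"
    using runit_iso[of m "lsrc X m" "ltgt X m"] m by (auto simp: loose_def)
  show "iso_in (Cells X) (runit X m)" by (rule i)
  show t: "arr (runit X m)" "ctop (runit X m) = m \<odot> unitl X (lsrc X m)" "cbot (runit X m) = m"
    "left X (runit X m) = tid X (lsrc X m)" "right X (runit X m) = tid X (ltgt X m)"
    using * m by (auto simp: globular_def cells_def hom_def loose_simps unitl_simps)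
  note k = V.inv_in_simps[OF i]
  show "arr (rinv m)" "ctop (rinv m) = m" "cbot (rinv m) = m \<odot> unitl X (lsrc X m)"
    "rinv m \<bullet> runit X m = cid X (m \<odot> unitl X (lsrc X m))" "runit X m \<bullet> rinv m = cid X m"
    using k t by simp_all
  show "left X (rinv m) = tid X (lsrc X m)" "right X (rinv m) = tid X (ltgt X m)"
    using m by (auto intro!: inv_boundary[OF i] simp: t loose_simps unitl_simps)
qed

lemmas typing = T.arr_simps(4-8) V.arr_simps unitl_simps loose_simps cell_simps hcomp_simps(1-5)
  unitc_simps assoc_simps lunit_simps(1-13) runit_simps

lemma hcomp_vcomp:
  assumes "arr a" "arr b" "arr a'" "arr b'" "cbot a = ctop a'" "cbot b = ctop b'"
    and "right X a = left X b" "right X a' = left X b'"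
  shows "(b' \<star> a') \<bullet> (b \<star> a) = (b' \<bullet> b) \<star> (a' \<bullet> a)"
  by (rule interchange[symmetric, where f = "left X a" and g = "left X b" and h = "right X b"
      and f' = "left X a'" and g' = "left X b'" and h' = "right X b'"])
    (use assms in \<open>auto simp: cells_def hom_def\<close>)

lemma assoc_nat:
  assumes "arr a" "arr b" "arr e" "right X a = left X b" "right X b = left X e"
  shows "assoc X (cbot e) (cbot b) (cbot a) \<bullet> (e \<star> b \<star> a) = (e \<star> (b \<star> a)) \<bullet> assoc X (ctop e) (ctop b) (ctop a)"
  by (rule assoc_natural[where f = "left X a" and g = "left X b" and h = "left X e" and k = "right X e"])
    (use assms in \<open>auto simp: cells_def hom_def\<close>)

lemma adjacent:
  assumes "arr a" "arr b" "right X a = left X b"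
  shows "ltgt X (ctop a) = lsrc X (ctop b)" "ltgt X (cbot a) = lsrc X (cbot b)"
  using cell_simps(5-8) assms by metis+

lemma ainv_nat:
  assumes "arr a" "arr b" "arr e" "right X a = left X b" "right X b = left X e"
  shows "ainv (cbot e) (cbot b) (cbot a) \<bullet> (e \<star> (b \<star> a)) = (e \<star> b \<star> a) \<bullet> ainv (ctop e) (ctop b) (ctop a)"
proof -
  note [simp] = typing adjacent[OF assms(1,2,4)] adjacent[OF assms(2,3,5)] assms
  have "assoc X (cbot e) (cbot b) (cbot a) \<bullet> (ainv (cbot e) (cbot b) (cbot a) \<bullet> (e \<star> (b \<star> a)))
      = assoc X (cbot e) (cbot b) (cbot a) \<bullet> ((e \<star> b \<star> a) \<bullet> ainv (ctop e) (ctop b) (ctop a))"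
    using assoc_nat[OF assms] V.arr_simps(9)[of "ainv (ctop e) (ctop b) (ctop a)" "e \<star> b \<star> a"
       "assoc X (cbot e) (cbot b) (cbot a)", symmetric] by simp
  then show ?thesis
    by (rule V.iso_cancel_left[rotated -1]) simp_all
qed

lemma lunit_nat:
  assumes "arr a" "right X a = g"
  shows "lunit X (cbot a) \<bullet> (unitc X g \<star> a) = a \<bullet> lunit X (ctop a)"
  by (rule lunit_natural[where f = "left X a" and g = "g"])
    (use assms in \<open>auto simp: cells_def hom_def\<close>)

lemma runit_nat:
  assumes "arr a" "left X a = f"
  shows "runit X (cbot a) \<bullet> (a \<star> unitc X f) = a \<bullet> runit X (ctop a)"
  by (rule runit_natural[where f = f and g = "right X a"])
    (use assms in \<open>auto simp: cells_def hom_def\<close>)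

lemma linv_nat:
  assumes a: "arr a" and g: "right X a = g"
  shows "linv (cbot a) \<bullet> a = (unitc X g \<star> a) \<bullet> linv (ctop a)"
proof -
  note [simp] = typing
  have ga: "g \<in> Ar (Tight X)" "Dom (Tight X) g = ltgt X (ctop a)" "Cod (Tight X) g = ltgt X (cbot a)"
    using a g by auto
  have "lunit X (cbot a) \<bullet> (linv (cbot a) \<bullet> a) = lunit X (cbot a) \<bullet> ((unitc X g \<star> a) \<bullet> linv (ctop a))"
    using a g ga lunit_nat[OF a g] V.arr_simps(9)[of "linv (ctop a)" "unitc X g \<star> a"
       "lunit X (cbot a)", symmetric] by (simp add: lunit_simps)
  then show ?thesis
    by (rule V.iso_cancel_left[rotated -1]) (use a g ga in simp_all)
qed

text \<open>
  Naturality of the left unitor makes whiskering with a loose identity conjugate to the identity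
  operation on cells that are globular on that side.
\<close>

lemma unit_whisker_inject:
  assumes "arr a" "arr b" "ctop a = ctop b" "cbot a = cbot b" "right X a = right X b"
    and eq: "unitc X (right X a) \<star> a = unitc X (right X b) \<star> b"
  shows "a = b"
proof -
  have "a \<bullet> lunit X (ctop a) = b \<bullet> lunit X (ctop a)"
    using lunit_nat[OF assms(1) refl] lunit_nat[OF assms(2) refl] assms by simp
  then show ?thesis
    by (rule V.iso_cancel_right[rotated -1]) (use assms in \<open>simp_all add: typing\<close>)
qed

lemma unit_whisker_inject':
  assumes "arr a" "arr b" "ctop a = ctop b" "cbot a = cbot b" "left X a = left X b"
    and eq: "a \<star> unitc X (left X a) = b \<star> unitc X (left X b)"
  shows "a = b"
proof -
  have "a \<bullet> runit X (ctop a) = b \<bullet> runit X (ctop a)"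
    using runit_nat[OF assms(1) refl] runit_nat[OF assms(2) refl] assms by simp
  then show ?thesis
    by (rule V.iso_cancel_right[rotated -1]) (use assms in \<open>simp_all add: typing\<close>)
qed

end

section \<open>Unit coherence\<close>

context pseudo_double_category
begin

text \<open>
  Kelly's argument: the pentagon for \<open>1, 1, n, m\<close> and two triangles show that both sides agree
  after whiskering with a loose identity on the left, which is a faithful operation.
\<close>

lemma lunit_lcomp:
  assumes m: "loose_arr m" and n: "loose_arr n" and mn: "ltgt X m = lsrc X n"
  shows "lunit X (n \<odot> m) \<bullet> assoc X (unitl X (ltgt X n)) n m = lunit X n \<star> cid X m"
proof -
  define z where "z = ltgt X n"
  define I where "I = unitl X z"
  have z: "z \<in> Ob (Tight X)" using n by (simp add: z_def typing)
  have I: "loose_arr I" "lsrc X I = z" "ltgt X I = z" using z by (simp_all add: I_def typing)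
  note [simp] = typing m n mn z I z_def[symmetric] I_def[symmetric]
  let ?A = "lunit X (n \<odot> m) \<bullet> assoc X I n m" and ?B = "lunit X n \<star> cid X m"
  have ll: "m \<in> loose X (lsrc X m) (lsrc X n)" "n \<in> loose X (lsrc X n) z" "I \<in> loose X z z"
     "n \<odot> m \<in> loose X (lsrc X m) z"
    by (auto simp: loose_def)
  have "(cid X I \<star> ?A) \<bullet> (assoc X I (I \<odot> n) m \<bullet> (assoc X I I n \<star> cid X m))
      = (cid X I \<star> lunit X (n \<odot> m)) \<bullet> ((cid X I \<star> assoc X I n m) \<bullet> (assoc X I (I \<odot> n) m \<bullet> (assoc X I I n \<star> cid X m)))"
    using hcomp_vcomp[of "assoc X I n m" "cid X I" "lunit X (n \<odot> m)" "cid X I"]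
      V.arr_simps(9)[of _ "cid X I \<star> assoc X I n m" "cid X I \<star> lunit X (n \<odot> m)", symmetric] by simp
  also have "\<dots> = (cid X I \<star> lunit X (n \<odot> m)) \<bullet> (assoc X I I (n \<odot> m) \<bullet> assoc X (I \<odot> I) n m)"
    using pentagon[OF ll(1,2,3,3)] by simp
  also have "\<dots> = (runit X I \<star> cid X (n \<odot> m)) \<bullet> assoc X (I \<odot> I) n m"
    using triangle[OF ll(4,3)] V.arr_simps(9)[of "assoc X (I \<odot> I) n m" "assoc X I I (n \<odot> m)"
      "cid X I \<star> lunit X (n \<odot> m)", symmetric] by simp
  also have "\<dots> = assoc X I n m \<bullet> (runit X I \<star> cid X n \<star> cid X m)"
    using assoc_nat[of "cid X m" "cid X n" "runit X I"] hcomp_simps(6)[of m n] by simp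
  also have "runit X I \<star> cid X n = (cid X I \<star> lunit X n) \<bullet> assoc X I I n"
    using triangle[OF ll(2,3)] by simp
  also have "((cid X I \<star> lunit X n) \<bullet> assoc X I I n) \<star> cid X m
      = (cid X I \<star> lunit X n \<star> cid X m) \<bullet> (assoc X I I n \<star> cid X m)"
    using hcomp_vcomp[of "cid X m" "assoc X I I n" "cid X m" "cid X I \<star> lunit X n"] by simp
  also have "assoc X I n m \<bullet> \<dots>
      = (cid X I \<star> ?B) \<bullet> (assoc X I (I \<odot> n) m \<bullet> (assoc X I I n \<star> cid X m))"
    using assoc_nat[of "cid X m" "lunit X n" "cid X I"]
      V.arr_simps(9)[of "assoc X I I n \<star> cid X m" "cid X I \<star> lunit X n \<star> cid X m" "assoc X I n m", symmetric]
    by simp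
  finally have eq: "(cid X I \<star> ?A) \<bullet> (assoc X I (I \<odot> n) m \<bullet> (assoc X I I n \<star> cid X m))
     = (cid X I \<star> ?B) \<bullet> (assoc X I (I \<odot> n) m \<bullet> (assoc X I I n \<star> cid X m))" .
  \<comment> \<open>The associators on the right are invertible and can be cancelled.\<close>
  have inv: "(assoc X I I n \<star> cid X m) \<bullet> ((ainv I I n \<star> cid X m) \<bullet> ainv I (I \<odot> n) m) = ainv I (I \<odot> n) m"
    using hcomp_vcomp[of "cid X m" "ainv I I n" "cid X m" "assoc X I I n"]
      V.arr_simps(9)[of "ainv I (I \<odot> n) m" "ainv I I n \<star> cid X m" "assoc X I I n \<star> cid X m", symmetric]
    by (simp add: hcomp_simps(6))
  have canc: "cid X I \<star> u = cid X I \<star> v"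
    if "(cid X I \<star> u) \<bullet> (assoc X I (I \<odot> n) m \<bullet> (assoc X I I n \<star> cid X m))
     = (cid X I \<star> v) \<bullet> (assoc X I (I \<odot> n) m \<bullet> (assoc X I I n \<star> cid X m))"
     "arr u" "arr v" "ctop u = I \<odot> n \<odot> m" "ctop v = I \<odot> n \<odot> m" "right X u = tid X z" "right X v = tid X z"
    for u v
  proof -
    have "((cid X I \<star> w) \<bullet> (assoc X I (I \<odot> n) m \<bullet> (assoc X I I n \<star> cid X m)))
        \<bullet> ((ainv I I n \<star> cid X m) \<bullet> ainv I (I \<odot> n) m) = cid X I \<star> w"
      if "arr w" "ctop w = I \<odot> n \<odot> m" "right X w = tid X z" for w
      using that inv by simp
    from this[of u] this[of v] that show ?thesis by simp
  qed
  have "cid X I \<star> ?A = cid X I \<star> ?B"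
    by (rule canc[OF eq]) simp_all
  then have "?A = ?B"
    by - (rule unit_whisker_inject, simp_all add: unitc_tid)
  then show ?thesis by simp
qed

text \<open>
  Naturality of the left unitor at itself gives \<open>lunit (1 \<odot> 1) = 1 \<star> lunit 1\<close>; combining
  the previous lemma with the triangle then yields \<open>lunit 1 \<star> 1 = runit 1 \<star> 1\<close>.
\<close>

lemma lunit_eq_runit:
  assumes z: "z \<in> Ob (Tight X)"
  shows "lunit X (unitl X z) = runit X (unitl X z)"
proof -
  define I where "I = unitl X z"
  have I: "loose_arr I" "lsrc X I = z" "ltgt X I = z" "I \<in> loose X z z"
    using z unitl_loose by (simp_all add: I_def typing)
  note [simp] = typing z I I_def[symmetric] unitc_tid
  have "lunit X I \<bullet> lunit X (I \<odot> I) = lunit X I \<bullet> (cid X I \<star> lunit X I)"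
    using lunit_nat[of "lunit X I" "tid X z"] by simp
  then have "lunit X (I \<odot> I) = cid X I \<star> lunit X I"
    by (rule V.iso_cancel_left[rotated -1]) simp_all
  then have "lunit X I \<star> cid X I = runit X I \<star> cid X I"
    using lunit_lcomp[of I I] triangle[OF I(4,4)] by simp
  then have "lunit X I = runit X I"
    by - (rule unit_whisker_inject', simp_all)
  then show ?thesis by simp
qed

end

section \<open>Conjoints and restrictions in an equipment\<close>

text \<open>
  The conjoint \<open>f'\<close> is the restriction of the loose identity of \<open>d'\<close> along \<open>(1, f)\<close>, with
  cartesian cell \<open>\<epsilon>\<close>.  The cell \<open>\<theta>\<close> is the factorization of \<open>unitc f\<close> through \<open>\<epsilon>\<close>, which is the
  first of the two conjunction identities; the second holds since both sides become equal
  after composition with \<open>\<epsilon>\<close>.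
\<close>

lemma (in equipment) conjoint:
  assumes f: "f \<in> hom (Tight X) d d'"
  obtains f' \<epsilon> \<theta> where "f' \<in> loose X d' d"
    and "\<epsilon> \<in> cells X f' (unitl X d') (tid X d') f" and "\<theta> \<in> cells X (unitl X d) f' f (tid X d)"
    and "\<epsilon> \<bullet> \<theta> = unitc X f" and "runit X f' \<bullet> (\<theta> \<star> \<epsilon>) = lunit X f'"
proof -
  have ff: "f \<in> Ar (Tight X)" "Dom (Tight X) f = d" "Cod (Tight X) f = d'"
    using f by (auto simp: hom_def)
  then have d: "d \<in> Ob (Tight X)" "d' \<in> Ob (Tight X)"
    using T.dom_ob[of f] T.cod_ob[of f] by auto
  obtain f' \<epsilon> where f': "f' \<in> loose X d' d" and \<epsilon>: "\<epsilon> \<in> cells X f' (unitl X d') (tid X d') f"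
    and cart: "cartesian X \<epsilon>"
    using restriction[OF unitl_loose[OF d(2)] T.ide_hom[OF d(2)] f] by blast
  have f'': "loose_arr f'" "lsrc X f' = d'" "ltgt X f' = d" using f' by (auto simp: loose_def)
  note \<epsilon>' = cellsD[OF \<epsilon>]
  note [simp] = typing ff d f'' \<epsilon>' unitc_tid T.arr_simps
  have univ: "\<exists>!b. b \<in> cells X m f' h k \<and> \<epsilon> \<bullet> b = a"
    if "h \<in> Ar (Tight X)" "k \<in> Ar (Tight X)" "Cod (Tight X) h = d'" "Cod (Tight X) k = d" "loose_arr m"
      "a \<in> cells X m (unitl X d') h (Comp (Tight X) f k)" for m h k a
    using cart that unfolding cartesian_def by simp
  have "\<exists>!b. b \<in> cells X (unitl X d) f' f (tid X d) \<and> \<epsilon> \<bullet> b = unitc X f"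
    by (rule univ) (auto intro!: cellsI)
  then obtain \<theta> where \<theta>: "\<theta> \<in> cells X (unitl X d) f' f (tid X d)" and \<epsilon>\<theta>: "\<epsilon> \<bullet> \<theta> = unitc X f"
    by blast
  note [simp] = cellsD[OF \<theta>]
  have 1: "\<epsilon> \<bullet> (runit X f' \<bullet> (\<theta> \<star> \<epsilon>)) = \<epsilon> \<bullet> lunit X f'"
  proof -
    have "\<epsilon> \<bullet> (runit X f' \<bullet> (\<theta> \<star> \<epsilon>)) = (\<epsilon> \<bullet> runit X f') \<bullet> (\<theta> \<star> \<epsilon>)"
      by simp
    also have "\<epsilon> \<bullet> runit X f' = runit X (unitl X d') \<bullet> (\<epsilon> \<star> cid X (unitl X d'))"
      using runit_nat[of \<epsilon> "tid X d'"] by simp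
    also have "\<dots> \<bullet> (\<theta> \<star> \<epsilon>) = runit X (unitl X d') \<bullet> (unitc X f \<star> \<epsilon>)"
      using hcomp_vcomp[of \<epsilon> \<theta> "cid X (unitl X d')" \<epsilon>] \<epsilon>\<theta> by simp
    also have "\<dots> = \<epsilon> \<bullet> lunit X f'"
      using lunit_nat[of \<epsilon> f] by (simp add: lunit_eq_runit)
    finally show ?thesis .
  qed
  have "\<exists>!b. b \<in> cells X (unitl X d \<odot> f') f' (tid X d') (tid X d) \<and> \<epsilon> \<bullet> b = \<epsilon> \<bullet> lunit X f'"
    by (rule univ) (auto intro!: cellsI)
  moreover have "runit X f' \<bullet> (\<theta> \<star> \<epsilon>) \<in> cells X (unitl X d \<odot> f') f' (tid X d') (tid X d)"
    "lunit X f' \<in> cells X (unitl X d \<odot> f') f' (tid X d') (tid X d)"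
    by (auto intro!: cellsI)
  ultimately have "runit X f' \<bullet> (\<theta> \<star> \<epsilon>) = lunit X f'"
    using 1 by metis
  then show thesis using that f' \<epsilon> \<theta> \<epsilon>\<theta> by blast
qed

context pseudo_double_category
begin

text \<open>
  The restriction of \<open>n\<close> along \<open>f\<close> on the target side is \<open>f' \<odot> n\<close>.  Pasting \<open>\<theta>\<close> to the target
  side of a cell inverts composition with \<open>\<kappa>\<close>: one composite is the identity by
  \<open>\<epsilon> \<bullet> \<theta> = unitc f\<close>, the other by the second conjunction identity, in the form that
  \<open>\<theta> \<star> \<kappa>\<close> is a unitor.
\<close>

lemma restriction_via_conjoint:
  assumes f': "f' \<in> loose X d' d" and \<epsilon>: "\<epsilon> \<in> cells X f' (unitl X d') (tid X d') f"
    and \<theta>: "\<theta> \<in> cells X (unitl X d) f' f (tid X d)"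
    and \<epsilon>\<theta>: "\<epsilon> \<bullet> \<theta> = unitc X f" and \<theta>\<epsilon>: "runit X f' \<bullet> (\<theta> \<star> \<epsilon>) = lunit X f'"
    and n: "n \<in> loose X x d'"
  defines "\<kappa> \<equiv> lunit X n \<bullet> (\<epsilon> \<star> cid X n)"
  shows "\<kappa> \<in> cells X (f' \<odot> n) n (tid X x) f"
    and "a \<in> cells X q n g f \<Longrightarrow> \<exists>!b. b \<in> cells X q (f' \<odot> n) g (tid X d) \<and> \<kappa> \<bullet> b = a"
proof -
  have l: "loose_arr f'" "lsrc X f' = d'" "ltgt X f' = d" "loose_arr n" "lsrc X n = x" "ltgt X n = d'"
    using f' n by (auto simp: loose_def)
  note [simp] = typing l cellsD[OF \<epsilon>] cellsD[OF \<theta>] unitc_tid T.arr_simps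
  have d: "d \<in> Ob (Tight X)" "d' \<in> Ob (Tight X)" "x \<in> Ob (Tight X)"
    using loose_simps(1,2)[of f'] loose_simps(1)[of n] by simp_all
  have f: "f \<in> Ar (Tight X)" "Dom (Tight X) f = d" "Cod (Tight X) f = d'"
    using cell_simps(4,7,8)[of \<epsilon>] d by simp_all
  note [simp] = d f
  have \<kappa>s: "arr \<kappa>" "ctop \<kappa> = f' \<odot> n" "cbot \<kappa> = n" "left X \<kappa> = tid X x" "right X \<kappa> = f"
    by (simp_all add: \<kappa>_def)
  note [simp] = \<kappa>s
  show "\<kappa> \<in> cells X (f' \<odot> n) n (tid X x) f"
    by (auto intro!: cellsI)
  have "(\<theta> \<star> \<kappa>) \<bullet> assoc X (unitl X d) f' n
      = ((cid X f' \<star> lunit X n) \<bullet> (\<theta> \<star> (\<epsilon> \<star> cid X n))) \<bullet> assoc X (unitl X d) f' n"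
    using hcomp_vcomp[of "\<epsilon> \<star> cid X n" \<theta> "lunit X n" "cid X f'"] by (simp add: \<kappa>_def)
  also have "\<dots> = (cid X f' \<star> lunit X n) \<bullet> (assoc X f' (unitl X d') n \<bullet> (\<theta> \<star> \<epsilon> \<star> cid X n))"
    using assoc_nat[of "cid X n" \<epsilon> \<theta>] by simp
  also have "\<dots> = ((cid X f' \<star> lunit X n) \<bullet> assoc X f' (unitl X d') n) \<bullet> (\<theta> \<star> \<epsilon> \<star> cid X n)"
    by simp
  also have "\<dots> = (runit X f' \<star> cid X n) \<bullet> (\<theta> \<star> \<epsilon> \<star> cid X n)"
    using triangle[OF n f'] by simp
  also have "\<dots> = lunit X f' \<star> cid X n"
    using hcomp_vcomp[of "cid X n" "\<theta> \<star> \<epsilon>" "cid X n" "runit X f'"] \<theta>\<epsilon> by simp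
  also have "\<dots> = lunit X (f' \<odot> n) \<bullet> assoc X (unitl X d) f' n"
    using lunit_lcomp[of n f'] by simp
  finally have \<theta>\<kappa>: "\<theta> \<star> \<kappa> = lunit X (f' \<odot> n)"
    by - (rule V.iso_cancel_right[of "assoc X (unitl X d) f' n"], simp_all)
  assume a: "a \<in> cells X q n g f"
  note [simp] = cellsD[OF a]
  have q: "loose_arr q" "ltgt X q = d"
    using cell_simps(1,7)[of a] by auto
  have g: "g \<in> Ar (Tight X)" "Dom (Tight X) g = lsrc X q" "Cod (Tight X) g = x"
    using cell_simps(3,5,6)[of a] by auto
  note [simp] = q g
  show "\<exists>!b. b \<in> cells X q (f' \<odot> n) g (tid X d) \<and> \<kappa> \<bullet> b = a"
  proof (rule ex1I[of _ "(\<theta> \<star> a) \<bullet> linv q"])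
    have "\<kappa> \<bullet> ((\<theta> \<star> a) \<bullet> linv q) = lunit X n \<bullet> (((\<epsilon> \<star> cid X n) \<bullet> (\<theta> \<star> a)) \<bullet> linv q)"
      by (simp add: \<kappa>_def)
    also have "\<dots> = lunit X n \<bullet> ((unitc X f \<star> a) \<bullet> linv q)"
      using hcomp_vcomp[of a \<theta> "cid X n" \<epsilon>] \<epsilon>\<theta> by simp
    also have "\<dots> = (lunit X n \<bullet> (unitc X f \<star> a)) \<bullet> linv q"
      by simp
    also have "\<dots> = a"
      using lunit_nat[of a f] by (simp add: lunit_simps)
    finally show "(\<theta> \<star> a) \<bullet> linv q \<in> cells X q (f' \<odot> n) g (tid X d) \<and> \<kappa> \<bullet> ((\<theta> \<star> a) \<bullet> linv q) = a"
      by (auto intro!: cellsI)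
  next
    fix b assume "b \<in> cells X q (f' \<odot> n) g (tid X d) \<and> \<kappa> \<bullet> b = a"
    then have b: "arr b" "ctop b = q" "cbot b = f' \<odot> n" "left X b = g" "right X b = tid X d"
      and ab: "a = \<kappa> \<bullet> b"
      by (auto dest: cellsD)
    note [simp] = b
    have "(\<theta> \<star> a) \<bullet> linv q = ((\<theta> \<star> \<kappa>) \<bullet> (unitc X (tid X d) \<star> b)) \<bullet> linv q"
      using hcomp_vcomp[of b "cid X (unitl X d)" \<kappa> \<theta>] ab by simp
    also have "\<dots> = lunit X (f' \<odot> n) \<bullet> ((unitc X (tid X d) \<star> b) \<bullet> linv q)"
      by (simp add: \<theta>\<kappa>)
    also have "\<dots> = lunit X (f' \<odot> n) \<bullet> (linv (f' \<odot> n) \<bullet> b)"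
      using linv_nat[of b "tid X d"] by simp
    also have "\<dots> = b"
      by (simp add: lunit_simps)
    finally show "b = (\<theta> \<star> a) \<bullet> linv q" ..
  qed
qed

end

text \<open>
  Restrictions along the target are stable under precomposition with loose arrows \<open>p\<close>.  For the
  restrictions built from a conjoint this holds because \<open>\<kappa> \<star> 1\<close> differs from the cell that
  restricts \<open>n \<odot> p\<close> only by an associator.  The arrow \<open>p\<close> will be a leg of the cocone.
\<close>

lemma (in equipment) restriction_stable:
  assumes n: "n \<in> loose X c d'" and f: "f \<in> hom (Tight X) d d'"
  obtains r \<kappa> where "r \<in> loose X c d" and "\<kappa> \<in> cells X r n (tid X c) f"
    and "\<And>a q g. a \<in> cells X q n g f \<Longrightarrow> \<exists>b \<in> cells X q r g (tid X d). \<kappa> \<bullet> b = a"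
    and "\<And>a p x q g. \<lbrakk>p \<in> loose X x c; a \<in> cells X q (n \<odot> p) g f\<rbrakk>
      \<Longrightarrow> \<exists>!b. b \<in> cells X q (r \<odot> p) g (tid X d) \<and> (\<kappa> \<star> cid X p) \<bullet> b = a"
proof -
  obtain f' \<epsilon> \<theta> where f': "f' \<in> loose X d' d" and \<epsilon>: "\<epsilon> \<in> cells X f' (unitl X d') (tid X d') f"
    and \<theta>: "\<theta> \<in> cells X (unitl X d) f' f (tid X d)"
    and eqs: "\<epsilon> \<bullet> \<theta> = unitc X f" "runit X f' \<bullet> (\<theta> \<star> \<epsilon>) = lunit X f'"
    using conjoint[OF f] .
  note W = restriction_via_conjoint[OF f' \<epsilon> \<theta> eqs]
  define \<kappa> where "\<kappa> n = lunit X n \<bullet> (\<epsilon> \<star> cid X n)" for n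
  have stable: "\<exists>!b. b \<in> cells X q (f' \<odot> n \<odot> p) g (tid X d) \<and> (\<kappa> n \<star> cid X p) \<bullet> b = a"
    if p: "p \<in> loose X x c" and a: "a \<in> cells X q (n \<odot> p) g f" for p x a q g
  proof -
    have l: "loose_arr f'" "lsrc X f' = d'" "ltgt X f' = d" "loose_arr n" "lsrc X n = c" "ltgt X n = d'"
      "loose_arr p" "lsrc X p = x" "ltgt X p = c"
      using f' n p by (auto simp: loose_def)
    note [simp] = typing l cellsD[OF \<epsilon>] cellsD[OF a]
    have ob: "d \<in> Ob (Tight X)" "d' \<in> Ob (Tight X)" "c \<in> Ob (Tight X)" "x \<in> Ob (Tight X)"
      using loose_simps(1,2)[of f'] loose_simps(1,2)[of p] by simp_all
    have f: "f \<in> Ar (Tight X)" "Dom (Tight X) f = d" "Cod (Tight X) f = d'"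
      using f by (auto simp: hom_def)
    have g: "g \<in> Ar (Tight X)" "Cod (Tight X) g = x"
      using cell_simps(3,6)[of a] by auto
    note [simp] = ob f g T.arr_simps
    have "\<kappa> n \<star> cid X p = (lunit X n \<star> cid X p) \<bullet> (\<epsilon> \<star> cid X n \<star> cid X p)"
      using hcomp_vcomp[of "cid X p" "\<epsilon> \<star> cid X n" "cid X p" "lunit X n"] by (simp add: \<kappa>_def)
    also have "\<dots> = lunit X (n \<odot> p) \<bullet> (assoc X (unitl X d') n p \<bullet> (\<epsilon> \<star> cid X n \<star> cid X p))"
      using lunit_lcomp[of p n, symmetric] by simp
    also have "\<dots> = lunit X (n \<odot> p) \<bullet> ((\<epsilon> \<star> cid X (n \<odot> p)) \<bullet> assoc X f' n p)"
      using assoc_nat[of "cid X p" "cid X n" \<epsilon>] hcomp_simps(6)[of p n] by simp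
    finally have eq: "\<kappa> n \<star> cid X p = \<kappa> (n \<odot> p) \<bullet> assoc X f' n p"
      by (simp add: \<kappa>_def)
    have np: "n \<odot> p \<in> loose X x d'" by (simp add: loose_def)
    note K = W[OF np, folded \<kappa>_def]
    note [simp] = cellsD[OF K(1)]
    from K(2)[OF a] obtain b where b: "b \<in> cells X q (f' \<odot> (n \<odot> p)) g (tid X d)" "\<kappa> (n \<odot> p) \<bullet> b = a"
      and uniq: "\<And>b'. b' \<in> cells X q (f' \<odot> (n \<odot> p)) g (tid X d) \<Longrightarrow> \<kappa> (n \<odot> p) \<bullet> b' = a \<Longrightarrow> b' = b"
      by blast
    show ?thesis
    proof (rule ex1I[of _ "ainv f' n p \<bullet> b"])
      show "ainv f' n p \<bullet> b \<in> cells X q (f' \<odot> n \<odot> p) g (tid X d)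
          \<and> (\<kappa> n \<star> cid X p) \<bullet> (ainv f' n p \<bullet> b) = a"
        using b(2) cellsD[OF b(1)] by (auto intro!: cellsI simp: eq)
    next
      fix b' assume "b' \<in> cells X q (f' \<odot> n \<odot> p) g (tid X d) \<and> (\<kappa> n \<star> cid X p) \<bullet> b' = a"
      then have b': "arr b'" "ctop b' = q" "cbot b' = f' \<odot> n \<odot> p" "left X b' = g" "right X b' = tid X d"
        and "(\<kappa> n \<star> cid X p) \<bullet> b' = a"
        by (auto dest: cellsD)
      then have "assoc X f' n p \<bullet> b' = b"
        by (intro uniq) (auto intro!: cellsI simp: eq)
      then show "b' = ainv f' n p \<bullet> b" using b' by auto
    qed
  qed
  show thesis
  proof (rule that[of "f' \<odot> n" "\<kappa> n"])
    show "f' \<odot> n \<in> loose X c d" by (rule lcomp_loose[OF n f'])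
    show "\<kappa> n \<in> cells X (f' \<odot> n) n (tid X c) f"
      using W(1)[OF n] by (simp add: \<kappa>_def)
    show "\<exists>b \<in> cells X q (f' \<odot> n) g (tid X d). \<kappa> n \<bullet> b = a" if "a \<in> cells X q n g f" for a q g
      using W(2)[OF n that] unfolding \<kappa>_def by blast
  qed (rule stable)
qed

section \<open>Modifications and whiskering with a cocone\<close>

context pseudo_double_category
begin

lemma id_modification_simps:
  "VO (id_tight_trans X F) i = tid X (FO F i)" "VL (id_tight_trans X F) u = cid X (FL F u)"
  "VO (const_tight_trans X f) i = f" "VL (const_tight_trans X f) u = unitc X f"
  by (simp_all add: id_tight_trans_def const_tight_trans_def)

lemma const_functor_simps:
  "FO (const_functor X d) i = d" "FT (const_functor X d) k = tid X d"
  "FL (const_functor X d) u = unitl X d" "FC (const_functor X d) a = cid X (unitl X d)"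
  by (simp_all add: const_functor_def)

text \<open>
  That an equivalence onto \<open>trans_cat\<close> is fully faithful rests on cancelling isomorphisms, so it
  needs the category laws.
\<close>

lemma trans_cat_category:
  assumes I: "pseudo_double_category I"
    and F: "\<And>u i j. u \<in> loose I i j \<Longrightarrow> FL F u \<in> loose X (FO F i) (FO F j)"
    and G: "\<And>u i j. u \<in> loose I i j \<Longrightarrow> FL G u \<in> loose X (FO G i) (FO G j)"
  shows "category (trans_cat I X F G)"
proof -
  interpret I: pseudo_double_category I by fact
  let ?F = "id_tight_trans X F" and ?G = "id_tight_trans X G"
  have arr: "\<sigma> \<in> Ob (trans_cat I X F G) \<longleftrightarrow> pseudo_loose_trans I X F G \<sigma>"
    "t \<in> hom (trans_cat I X F G) \<sigma> \<tau> \<longleftrightarrow> (\<exists>\<mu>. t = (\<sigma>, \<mu>, \<tau>) \<and> pseudo_loose_trans I X F G \<sigma>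
       \<and> pseudo_loose_trans I X F G \<tau> \<and> modification I X ?F ?G \<sigma> \<tau> \<mu>)" for \<sigma> \<tau> t
    by (auto simp: trans_cat_def hom_def)
  have loose_ob: "i \<in> Ob (Tight I)" "j \<in> Ob (Tight I)" if "u \<in> loose I i j" for u i j
    using that I.loose_simps(1,2) by (auto simp: loose_def)
  have comp: "TO \<sigma> i \<in> loose X (FO F i) (FO G i)"
    if "pseudo_loose_trans I X F G \<sigma>" "i \<in> Ob (Tight I)" for \<sigma> i
    using pseudo_loose_trans.component[OF that] .
  have TT: "TT \<sigma> f \<in> hom (Cells X) (TO \<sigma> i) (TO \<sigma> j)"
    if "pseudo_loose_trans I X F G \<sigma>" "f \<in> hom (Tight I) i j" for \<sigma> f i j
    using cat_functor.ar[OF pseudo_loose_trans.tight_functor[OF that(1)] that(2)] .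
  have TL: "TL \<sigma> u \<in> hom (Cells X) (TO \<sigma> j \<odot> FL F u) (FL G u \<odot> TO \<sigma> i)"
    if "pseudo_loose_trans I X F G \<sigma>" "u \<in> loose I i j" for \<sigma> u i j
    using pseudo_loose_trans.component_loose[OF that] by (simp add: globular_def cells_def)
  have id_mod: "modification I X ?F ?G \<sigma> \<sigma> (\<lambda>i\<in>Ob (Tight I). cid X (TO \<sigma> i))"
    if \<sigma>: "pseudo_loose_trans I X F G \<sigma>" for \<sigma>
  proof (unfold_locales, goal_cases)
    case (2 i)
    then show ?case using comp[OF \<sigma> 2]
      by (auto intro!: cellsI simp: typing loose_def id_modification_simps)
  next
    case (3 f i j)
    then have "i \<in> Ob (Tight I)" "j \<in> Ob (Tight I)"
      using I.T.dom_ob I.T.cod_ob by (auto simp: hom_def)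
    then show ?case using TT[OF \<sigma> 3] by (simp add: V.arr_simps hom_def)
  next
    case (4 u i j)
    note o = loose_ob[OF 4]
    show ?case
      using TL[OF \<sigma> 4] F[OF 4] G[OF 4] comp[OF \<sigma> o(1)] comp[OF \<sigma> o(2)] o
      by (simp add: id_modification_simps hcomp_simps loose_def hom_def V.arr_simps)
  qed simp
  have comp_mod: "modification I X ?F ?G \<sigma> \<rho> (\<lambda>i\<in>Ob (Tight I). \<nu> i \<bullet> \<mu> i)"
    if \<sigma>: "pseudo_loose_trans I X F G \<sigma>" and \<tau>: "pseudo_loose_trans I X F G \<tau>"
      and \<rho>: "pseudo_loose_trans I X F G \<rho>"
      and \<mu>: "modification I X ?F ?G \<sigma> \<tau> \<mu>" and \<nu>: "modification I X ?F ?G \<tau> \<rho> \<nu>" for \<sigma> \<tau> \<rho> \<mu> \<nu>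
  proof (unfold_locales, goal_cases)
    case (2 i)
    note c = comp[OF \<sigma> 2] comp[OF \<tau> 2] comp[OF \<rho> 2] cellsD[OF modification.component[OF \<mu> 2]]
      cellsD[OF modification.component[OF \<nu> 2]]
    have "FO F i \<in> Ob (Tight X)" "FO G i \<in> Ob (Tight X)"
      using c(1) loose_simps(1,2)[of "TO \<sigma> i"] by (auto simp: loose_def)
    then show ?case using c 2
      by (auto intro!: cellsI simp: typing T.arr_simps loose_def id_modification_simps)
  next
    case (3 f i j)
    have o: "i \<in> Ob (Tight I)" "j \<in> Ob (Tight I)"
      using I.T.dom_ob I.T.cod_ob 3 by (auto simp: hom_def)
    note h = cellsD[OF modification.component[OF \<mu> o(1)]] cellsD[OF modification.component[OF \<nu> o(1)]]
      cellsD[OF modification.component[OF \<mu> o(2)]] cellsD[OF modification.component[OF \<nu> o(2)]]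
    have "TT \<rho> f \<bullet> (\<nu> i \<bullet> \<mu> i) = (TT \<rho> f \<bullet> \<nu> i) \<bullet> \<mu> i"
      using TT[OF \<rho> 3] h by (simp add: V.arr_simps hom_def)
    also have "\<dots> = \<nu> j \<bullet> (TT \<tau> f \<bullet> \<mu> i)"
      using TT[OF \<tau> 3] h modification.tight[OF \<nu> 3] by (simp add: V.arr_simps hom_def)
    also have "\<dots> = (\<nu> j \<bullet> \<mu> j) \<bullet> TT \<sigma> f"
      using TT[OF \<sigma> 3] h modification.tight[OF \<mu> 3] by (simp add: V.arr_simps hom_def)
    finally show ?case using o by simp
  next
    case (4 u i j)
    note o = loose_ob[OF 4]
    note h = cellsD[OF modification.component[OF \<mu> o(1)]] cellsD[OF modification.component[OF \<nu> o(1)]]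
      cellsD[OF modification.component[OF \<mu> o(2)]] cellsD[OF modification.component[OF \<nu> o(2)]]
    have l: "loose_arr (FL F u)" "ltgt X (FL F u) = FO F j" "loose_arr (FL G u)" "lsrc X (FL G u) = FO G i"
      using F[OF 4] G[OF 4] by (auto simp: loose_def)
    note t = TL[OF \<sigma> 4] TL[OF \<tau> 4] TL[OF \<rho> 4]
    note [simp] = typing h l id_modification_simps
    have "(cid X (FL G u) \<star> (\<nu> i \<bullet> \<mu> i)) \<bullet> TL \<sigma> u
        = (cid X (FL G u) \<star> \<nu> i) \<bullet> ((cid X (FL G u) \<star> \<mu> i) \<bullet> TL \<sigma> u)"
      using t hcomp_vcomp[of "\<mu> i" "cid X (FL G u)" "\<nu> i" "cid X (FL G u)", symmetric]
      by (simp add: hom_def)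
    also have "\<dots> = ((cid X (FL G u) \<star> \<nu> i) \<bullet> TL \<tau> u) \<bullet> (\<mu> j \<star> cid X (FL F u))"
      using t modification.loose[OF \<mu> 4] by (simp add: hom_def)
    also have "\<dots> = TL \<rho> u \<bullet> ((\<nu> j \<star> cid X (FL F u)) \<bullet> (\<mu> j \<star> cid X (FL F u)))"
      using t modification.loose[OF \<nu> 4] by (simp add: hom_def)
    also have "\<dots> = TL \<rho> u \<bullet> ((\<nu> j \<bullet> \<mu> j) \<star> cid X (FL F u))"
      using hcomp_vcomp[of "cid X (FL F u)" "\<mu> j" "cid X (FL F u)" "\<nu> j"] by simp
    finally show ?case using o by simp
  qed simp
  show ?thesis
  proof (unfold_locales, goal_cases)
    case (1 t) then show ?case by (auto simp: trans_cat_def)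
  next
    case (2 t) then show ?case by (auto simp: trans_cat_def)
  next
    case (3 \<sigma>) then show ?case using id_mod unfolding arr by (auto simp: trans_cat_def)
  next
    case (4 s \<sigma> \<tau> t \<rho>) then show ?case using comp_mod unfolding arr by (auto simp: trans_cat_def)
  next
    case (5 t \<sigma> \<tau>)
    then obtain \<mu> where t: "t = (\<sigma>, \<mu>, \<tau>)" and \<mu>: "modification I X ?F ?G \<sigma> \<tau> \<mu>"
      unfolding arr by blast
    have "(\<lambda>i\<in>Ob (Tight I). cid X (TO \<tau> i) \<bullet> \<mu> i) = \<mu>"
      using modification.extensional[OF \<mu>] cellsD[OF modification.component[OF \<mu>]]
      by (intro extensionalityI[of _ "Ob (Tight I)"]) (auto simp: V.arr_simps)
    then show ?case by (simp add: t trans_cat_def cong: restrict_cong)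
  next
    case (6 t \<sigma> \<tau>)
    then obtain \<mu> where t: "t = (\<sigma>, \<mu>, \<tau>)" and \<mu>: "modification I X ?F ?G \<sigma> \<tau> \<mu>"
      unfolding arr by blast
    have "(\<lambda>i\<in>Ob (Tight I). \<mu> i \<bullet> cid X (TO \<sigma> i)) = \<mu>"
      using modification.extensional[OF \<mu>] cellsD[OF modification.component[OF \<mu>]]
      by (intro extensionalityI[of _ "Ob (Tight I)"]) (auto simp: V.arr_simps)
    then show ?case by (simp add: t trans_cat_def cong: restrict_cong)
  next
    case (7 t1 s1 s2 t2 s3 t3 s4)
    then obtain m1 m2 m3 where t: "t1 = (s1, m1, s2)" "t2 = (s2, m2, s3)" "t3 = (s3, m3, s4)"
      and m: "modification I X ?F ?G s1 s2 m1" "modification I X ?F ?G s2 s3 m2"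
        "modification I X ?F ?G s3 s4 m3"
      unfolding arr by blast
    then show ?case
      using cellsD[OF modification.component[OF m(1)]] cellsD[OF modification.component[OF m(2)]]
        cellsD[OF modification.component[OF m(3)]]
      by (simp add: t trans_cat_def V.arr_simps cong: restrict_cong)
  qed
qed

text \<open>
  Pasting of two commuting squares, by which the naturality of a composite is reduced to the
  naturality of its factors.
\<close>

lemma square_paste:
  assumes "k2 \<bullet> x = y \<bullet> k1" and "k2' \<bullet> y = z \<bullet> k1'"
    and "arr x" "arr y" "arr z" "arr k1" "arr k1'" "arr k2" "arr k2'"
    and "cbot x = ctop k2" "cbot k2 = ctop k2'" "cbot k1 = ctop y" "cbot y = ctop k2'" "cbot k1' = ctop z" "cbot k1 = ctop k1'"
  shows "(k2' \<bullet> k2) \<bullet> x = z \<bullet> (k1' \<bullet> k1)"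
proof -
  have "(k2' \<bullet> k2) \<bullet> x = k2' \<bullet> (y \<bullet> k1)" using assms by (simp add: V.arr_simps)
  also have "\<dots> = (z \<bullet> k1') \<bullet> k1" using assms by (simp add: V.arr_simps flip: assms(2))
  also have "\<dots> = z \<bullet> (k1' \<bullet> k1)" using assms by (simp add: V.arr_simps)
  finally show ?thesis .
qed

text \<open>
  The long composites are the components of \<open>t m\<close> and \<open>t n\<close> at a loose arrow of the shape, where
  \<open>p\<close> and \<open>q\<close> are legs of the cocone, \<open>v\<close> is the image of that arrow under the diagram and
  \<open>h\<close> is the component of the cocone.  Each of the five factors is natural in \<open>m\<close>, also with
  respect to cells that are not globular on the right.
\<close>

lemma cocone_cell_natural:
  assumes m: "m \<in> loose X c d" and n: "n \<in> loose X c d'" and a: "a \<in> cells X m n (tid X c) f"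
    and p: "p \<in> loose X x c" and q: "q \<in> loose X y c" and v: "v \<in> loose X x y"
    and h: "h \<in> globular X (q \<odot> v) (unitl X c \<odot> p)"
  shows "(unitc X f \<star> (a \<star> cid X p))
      \<bullet> (assoc X (unitl X d) m p \<bullet> ((linv m \<bullet> runit X m) \<star> cid X p) \<bullet> ainv m (unitl X c) p
         \<bullet> (cid X m \<star> h) \<bullet> assoc X m q v)
    = (assoc X (unitl X d') n p \<bullet> ((linv n \<bullet> runit X n) \<star> cid X p) \<bullet> ainv n (unitl X c) p
         \<bullet> (cid X n \<star> h) \<bullet> assoc X n q v) \<bullet> (a \<star> cid X q \<star> cid X v)"
proof -
  have l: "loose_arr m" "loose_arr n" "loose_arr p" "loose_arr q" "loose_arr v" "lsrc X m = c" "ltgt X m = d" "lsrc X n = c" "ltgt X n = d'"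
    "lsrc X p = x" "ltgt X p = c" "lsrc X q = y" "ltgt X q = c" "lsrc X v = x" "ltgt X v = y"
    using m n p q v by (auto simp: loose_def)
  note [simp] = typing l cellsD[OF a] unitc_tid T.arr_simps
  have ob: "c \<in> Ob (Tight X)" "d \<in> Ob (Tight X)" "d' \<in> Ob (Tight X)" "x \<in> Ob (Tight X)"
    using loose_simps(1,2)[of m] loose_simps(2)[of n] loose_simps(1)[of p] by simp_all
  note [simp] = ob
  have h': "arr h" "ctop h = q \<odot> v" "cbot h = unitl X c \<odot> p" "left X h = tid X x" "right X h = tid X c"
    using h by (auto simp: globular_def dest: cellsD)
  have f: "f \<in> Ar (Tight X)" "Dom (Tight X) f = d" "Cod (Tight X) f = d'"
    using cell_simps(4,7,8)[of a] by simp_all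
  note [simp] = h' f
  have s5: "assoc X n q v \<bullet> (a \<star> cid X q \<star> cid X v) = (a \<star> cid X (q \<odot> v)) \<bullet> assoc X m q v"
    using assoc_nat[of "cid X v" "cid X q" a] hcomp_simps(6)[of v q] by simp
  have s4: "(cid X n \<star> h) \<bullet> (a \<star> cid X (q \<odot> v)) = (a \<star> cid X (unitl X c \<odot> p)) \<bullet> (cid X m \<star> h)"
    using hcomp_vcomp[of "cid X (q \<odot> v)" a h "cid X n"]
      hcomp_vcomp[of h "cid X m" "cid X (unitl X c \<odot> p)" a] by simp
  have s3: "ainv n (unitl X c) p \<bullet> (a \<star> cid X (unitl X c \<odot> p))
      = (a \<star> cid X (unitl X c) \<star> cid X p) \<bullet> ainv m (unitl X c) p"
    using ainv_nat[of "cid X p" "cid X (unitl X c)" a] hcomp_simps(6)[of p "unitl X c"] by simp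
  have "(linv n \<bullet> runit X n) \<bullet> (a \<star> cid X (unitl X c)) = (unitc X f \<star> a) \<bullet> (linv m \<bullet> runit X m)"
    by (rule square_paste[where y = a])
      (use runit_nat[of a "tid X c"] linv_nat[of a f] in simp_all)
  then have s2: "((linv n \<bullet> runit X n) \<star> cid X p) \<bullet> (a \<star> cid X (unitl X c) \<star> cid X p)
      = (unitc X f \<star> a \<star> cid X p) \<bullet> ((linv m \<bullet> runit X m) \<star> cid X p)"
    using hcomp_vcomp[of "cid X p" "a \<star> cid X (unitl X c)" "cid X p" "linv n \<bullet> runit X n"]
      hcomp_vcomp[of "cid X p" "linv m \<bullet> runit X m" "cid X p" "unitc X f \<star> a"]
    by (simp del: V.arr_simps(9))
  have s1: "assoc X (unitl X d') n p \<bullet> (unitc X f \<star> a \<star> cid X p)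
      = (unitc X f \<star> (a \<star> cid X p)) \<bullet> assoc X (unitl X d) m p"
    using assoc_nat[of "cid X p" a "unitc X f"] by simp
  have "(((assoc X (unitl X d') n p \<bullet> ((linv n \<bullet> runit X n) \<star> cid X p)) \<bullet> ainv n (unitl X c) p)
         \<bullet> (cid X n \<star> h)) \<bullet> assoc X n q v \<bullet> (a \<star> cid X q \<star> cid X v)
   = (unitc X f \<star> (a \<star> cid X p)) \<bullet> ((((assoc X (unitl X d) m p \<bullet> ((linv m \<bullet> runit X m) \<star> cid X p))
       \<bullet> ainv m (unitl X c) p) \<bullet> (cid X m \<star> h)) \<bullet> assoc X m q v)"
    by (rule square_paste[OF s5 square_paste[OF s4 square_paste[OF s3 square_paste[OF s2 s1]]]])
      simp_all
  then show ?thesis by (rule sym)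
qed

end

locale loose_cocone = pseudo_double_category X for X :: "('o, 't, 'l, 'c) dblcat" (structure) +
  fixes I :: "('io, 'it, 'il, 'ic) dblcat"
    and D :: "('io, 'it, 'il, 'ic, 'o, 't, 'l, 'c) dblfunctor"
    and c :: 'o and \<eta> :: "('io, 'it, 'il, 'l, 'c) loose_trans"
  assumes bicategory_I: "bicategory I"
    and lax_D: "lax_double_functor I X D"
    and cocone: "pseudo_loose_trans I X D (const_functor X c) \<eta>"
begin

sublocale I: bicategory I by (rule bicategory_I)

lemma shape_simps:
  assumes "u \<in> loose I i j"
  shows "u \<in> Ob (Cells I)" "lsrc I u = i" "ltgt I u = j" "i \<in> Ob (Tight I)" "j \<in> Ob (Tight I)"
  using assms I.loose_simps(1,2)[of u] by (auto simp: loose_def)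

lemma tight_shape:
  assumes "k \<in> hom (Tight I) i j"
  shows "k = tid I i" "j = i" "i \<in> Ob (Tight I)"
proof -
  obtain z where "z \<in> Ob (Tight I)" "k = tid I z"
    using assms I.tight_identities by (auto simp: hom_def)
  then show "k = tid I i" "j = i" "i \<in> Ob (Tight I)"
    using assms I.T.arr_simps(4-6) by (auto simp: hom_def)
qed

lemma diagram_loose: "u \<in> loose I i j \<Longrightarrow> FL D u \<in> loose X (FO D i) (FO D j)"
  by (rule lax_double_functor.loose[OF lax_D])

lemma cocone_component: "i \<in> Ob (Tight I) \<Longrightarrow> TO \<eta> i \<in> loose X (FO D i) c"
  using pseudo_loose_trans.component[OF cocone] by (simp add: const_functor_simps)

lemma cocone_component_loose:
  "u \<in> loose I i j \<Longrightarrow> TL \<eta> u \<in> globular X (TO \<eta> j \<odot> FL D u) (unitl X c \<odot> TO \<eta> i)"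
  using pseudo_loose_trans.component_loose[OF cocone] by (simp add: const_functor_simps)

abbreviation t where "t \<equiv> cocone_map I X D \<eta>"
abbreviation t_cell where "t_cell \<equiv> cocone_map_cell I X \<eta>"

lemma cocone_map_TO: "i \<in> Ob (Tight I) \<Longrightarrow> TO (t m) i = m \<odot> TO \<eta> i"
  by (simp add: cocone_map_def trans_comp_def const_loose_trans_def)

lemma cocone_map_TT:
  assumes "m \<in> loose X c d" and "i \<in> Ob (Tight I)"
  shows "TT (t m) (tid I i) = cid X (m \<odot> TO \<eta> i)"
proof -
  have "TT \<eta> (tid I i) = cid X (TO \<eta> i)"
    using cat_functor.pres_ide[OF pseudo_loose_trans.tight_functor[OF cocone] assms(2)] .
  then show ?thesis
    using assms cocone_component[OF assms(2)] I.T.arr_simps(4) hcomp_ide[OF _ assms(1)]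
    by (simp add: cocone_map_def trans_comp_def const_loose_trans_def)
qed

lemma cocone_map_TL:
  assumes m: "m \<in> loose X c d" and u: "u \<in> loose I i j"
  shows "TL (t m) u = assoc X (unitl X d) m (TO \<eta> i) \<bullet> ((linv m \<bullet> runit X m) \<star> cid X (TO \<eta> i))
      \<bullet> ainv m (unitl X c) (TO \<eta> i) \<bullet> (cid X m \<star> TL \<eta> u) \<bullet> assoc X m (TO \<eta> j) (FL D u)"
  using shape_simps[OF u] m
  by (simp add: cocone_map_def trans_comp_def const_loose_trans_def const_functor_simps loose_def Let_def)

lemma cocone_map_TL_cell:
  assumes m: "m \<in> loose X c d" and u: "u \<in> loose I i j"
  shows "TL (t m) u \<in> cells X (m \<odot> TO \<eta> j \<odot> FL D u) (unitl X d \<odot> (m \<odot> TO \<eta> i)) (tid X (FO D i)) (tid X d)"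
proof -
  note s = shape_simps[OF u]
  have l: "loose_arr m" "loose_arr (TO \<eta> i)" "loose_arr (TO \<eta> j)" "loose_arr (FL D u)" "lsrc X m = c" "ltgt X m = d"
    "lsrc X (TO \<eta> i) = FO D i" "ltgt X (TO \<eta> i) = c" "lsrc X (TO \<eta> j) = FO D j" "ltgt X (TO \<eta> j) = c"
    "lsrc X (FL D u) = FO D i" "ltgt X (FL D u) = FO D j"
    using m diagram_loose[OF u] cocone_component[OF s(4)] cocone_component[OF s(5)]
    by (auto simp: loose_def)
  note [simp] = typing l T.arr_simps
  have ob: "c \<in> Ob (Tight X)" "d \<in> Ob (Tight X)" "FO D i \<in> Ob (Tight X)"
    using loose_simps(1,2)[of m] loose_simps(1)[of "TO \<eta> i"] by simp_all
  have h: "arr (TL \<eta> u)" "ctop (TL \<eta> u) = TO \<eta> j \<odot> FL D u" "cbot (TL \<eta> u) = unitl X c \<odot> TO \<eta> i"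
    "left X (TL \<eta> u) = tid X (FO D i)" "right X (TL \<eta> u) = tid X c"
    using cocone_component_loose[OF u] by (auto simp: globular_def dest: cellsD)
  show ?thesis
    unfolding cocone_map_TL[OF m u] using ob h by (auto intro!: cellsI)
qed

text \<open>
  The loose condition is the naturality \<open>cocone_cell_natural\<close>; the tight one is trivial because the shape
  has only identities as tight arrows.
\<close>

lemma cocone_map_cell_modification:
  assumes m: "m \<in> loose X c d" and n: "n \<in> loose X c d'" and a: "a \<in> cells X m n (tid X c) f"
  shows "modification I X (id_tight_trans X D) (const_tight_trans X f) (t m) (t n) (t_cell a)"
proof (unfold_locales, goal_cases)
  case 1 show ?case by (simp add: cocone_map_cell_def)
next
  case (2 i)
  have p: "loose_arr (TO \<eta> i)" "lsrc X (TO \<eta> i) = FO D i" "ltgt X (TO \<eta> i) = c"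
    using cocone_component[OF 2] by (auto simp: loose_def)
  show ?case
    using 2 p cellsD[OF a]
    by (auto intro!: cellsI simp: cocone_map_TO cocone_map_cell_def id_modification_simps typing)
next
  case (3 k i j)
  note k = tight_shape[OF 3]
  have p: "loose_arr (TO \<eta> i)" "lsrc X (TO \<eta> i) = FO D i" "ltgt X (TO \<eta> i) = c"
    using cocone_component[OF k(3)] by (auto simp: loose_def)
  show ?case
    unfolding k(1,2) cocone_map_TT[OF m k(3)] cocone_map_TT[OF n k(3)]
    using k(3) p cellsD[OF a] by (simp add: cocone_map_cell_def typing)
next
  case (4 u i j)
  note s = shape_simps[OF 4]
  show ?case
    unfolding cocone_map_TL[OF m 4] cocone_map_TL[OF n 4]
    using cocone_cell_natural[OF m n a cocone_component[OF s(4)] cocone_component[OF s(5)]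
        diagram_loose[OF 4] cocone_component_loose[OF 4]] s(4,5)
    by (simp add: cocone_map_cell_def id_modification_simps)
qed

lemma cocone_map_cell_vcomp:
  assumes "\<kappa> \<in> cells X r n (tid X c) f" and "b \<in> cells X m r (tid X c) g" and i: "i \<in> Ob (Tight I)"
  shows "t_cell (\<kappa> \<bullet> b) i = (\<kappa> \<star> cid X (TO \<eta> i)) \<bullet> t_cell b i"
proof -
  have p: "loose_arr (TO \<eta> i)" "ltgt X (TO \<eta> i) = c"
    using cocone_component[OF i] by (auto simp: loose_def)
  show ?thesis
    using cellsD[OF assms(1)] cellsD[OF assms(2)] p i
      hcomp_vcomp[of "cid X (TO \<eta> i)" b "cid X (TO \<eta> i)" \<kappa>]
    by (simp add: cocone_map_cell_def typing)
qed

text \<open>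
  The components of \<open>\<mu>\<close> factor through those of \<open>t \<kappa>\<close> because the latter are cartesian.  That the
  factors satisfy the modification equation is checked after composition with the components of
  \<open>t \<kappa>\<close>, where it becomes the modification equation of \<open>\<mu>\<close> by that of \<open>t \<kappa>\<close>.
\<close>

lemma modification_factors:
  assumes m: "m \<in> loose X c d" and n: "n \<in> loose X c d'" and r: "r \<in> loose X c d"
    and f: "f \<in> hom (Tight X) d d'"
    and \<kappa>: "\<kappa> \<in> cells X r n (tid X c) f"
    and cart: "\<And>a p x q g. \<lbrakk>p \<in> loose X x c; a \<in> cells X q (n \<odot> p) g f\<rbrakk>
      \<Longrightarrow> \<exists>!b. b \<in> cells X q (r \<odot> p) g (tid X d) \<and> (\<kappa> \<star> cid X p) \<bullet> b = a"
    and \<mu>: "modification I X (id_tight_trans X D) (const_tight_trans X f) (t m) (t n) \<mu>"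
  shows "\<exists>\<nu>. modification I X (id_tight_trans X D) (const_tight_trans X (tid X d)) (t m) (t r) \<nu>
     \<and> (\<forall>i \<in> Ob (Tight I). \<mu> i = (\<kappa> \<star> cid X (TO \<eta> i)) \<bullet> \<nu> i)"
proof -
  have ml: "loose_arr m" "loose_arr n" "loose_arr r" "lsrc X m = c" "ltgt X m = d" "lsrc X n = c" "ltgt X n = d'"
    "lsrc X r = c" "ltgt X r = d"
    using m n r by (auto simp: loose_def)
  have ff: "f \<in> Ar (Tight X)" "Dom (Tight X) f = d" "Cod (Tight X) f = d'"
    using f by (auto simp: hom_def)
  have d: "c \<in> Ob (Tight X)" "d \<in> Ob (Tight X)" "d' \<in> Ob (Tight X)"
    using ml loose_simps(1,2)[of m] loose_simps(2)[of n] by auto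
  have comp: "\<mu> i \<in> cells X (m \<odot> TO \<eta> i) (n \<odot> TO \<eta> i) (tid X (FO D i)) f" if "i \<in> Ob (Tight I)" for i
    using modification.component[OF \<mu> that] that by (simp add: cocone_map_TO id_modification_simps)
  have "\<forall>i \<in> Ob (Tight I). \<exists>b. b \<in> cells X (m \<odot> TO \<eta> i) (r \<odot> TO \<eta> i) (tid X (FO D i)) (tid X d)
      \<and> (\<kappa> \<star> cid X (TO \<eta> i)) \<bullet> b = \<mu> i"
    using cart[OF cocone_component comp] by blast
  then obtain \<nu>' where \<nu>': "\<And>i. i \<in> Ob (Tight I)
      \<Longrightarrow> \<nu>' i \<in> cells X (m \<odot> TO \<eta> i) (r \<odot> TO \<eta> i) (tid X (FO D i)) (tid X d)
        \<and> (\<kappa> \<star> cid X (TO \<eta> i)) \<bullet> \<nu>' i = \<mu> i"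
    by metis
  define \<nu> where "\<nu> = restrict \<nu>' (Ob (Tight I))"
  have \<nu>: "\<nu> i \<in> cells X (m \<odot> TO \<eta> i) (r \<odot> TO \<eta> i) (tid X (FO D i)) (tid X d)"
    and \<kappa>\<nu>: "(\<kappa> \<star> cid X (TO \<eta> i)) \<bullet> \<nu> i = \<mu> i" if "i \<in> Ob (Tight I)" for i
    using \<nu>'[OF that] that by (simp_all add: \<nu>_def)
  have p: "loose_arr (TO \<eta> i)" "lsrc X (TO \<eta> i) = FO D i" "ltgt X (TO \<eta> i) = c" "FO D i \<in> Ob (Tight X)"
    if "i \<in> Ob (Tight I)" for i
    using cocone_component[OF that] loose_simps(1)[of "TO \<eta> i"] by (auto simp: loose_def)
  have "modification I X (id_tight_trans X D) (const_tight_trans X (tid X d)) (t m) (t r) \<nu>"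
  proof (unfold_locales, goal_cases)
    case 1 show ?case by (simp add: \<nu>_def)
  next
    case (2 i)
    then show ?case using \<nu> by (simp add: cocone_map_TO id_modification_simps)
  next
    case (3 k i j)
    note k = tight_shape[OF 3]
    show ?case
      unfolding k(1,2) cocone_map_TT[OF m k(3)] cocone_map_TT[OF r k(3)]
      using k(3) p[OF k(3)] ml cellsD[OF \<nu>[OF k(3)]] by (simp add: typing)
  next
    case (4 u i j)
    note s = shape_simps[OF 4]
    have v: "loose_arr (FL D u)" "lsrc X (FL D u) = FO D i" "ltgt X (FL D u) = FO D j"
      using diagram_loose[OF 4] by (auto simp: loose_def)
    note [simp] = typing T.arr_simps ml d p[OF s(4)] p[OF s(5)] v unitc_tid cellsD[OF \<kappa>]
      cellsD[OF \<nu>[OF s(4)]] cellsD[OF \<nu>[OF s(5)]] cellsD[OF cocone_map_TL_cell[OF m 4]]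
      cellsD[OF cocone_map_TL_cell[OF r 4]] cellsD[OF cocone_map_TL_cell[OF n 4]] ff
    define K where "K = \<kappa> \<star> cid X (TO \<eta> i)"
    have K[simp]: "arr K" "ctop K = r \<odot> TO \<eta> i" "cbot K = n \<odot> TO \<eta> i" "left X K = tid X (FO D i)" "right X K = f"
      by (simp_all add: K_def)
    define L where "L = (cid X (unitl X d) \<star> \<nu> i) \<bullet> TL (t m) u"
    define R where "R = TL (t r) u \<bullet> (\<nu> j \<star> cid X (FL D u))"
    have LR: "arr L" "ctop L = m \<odot> TO \<eta> j \<odot> FL D u" "cbot L = unitl X d \<odot> (r \<odot> TO \<eta> i)"
      "left X L = tid X (FO D i)" "right X L = tid X d"
      "arr R" "ctop R = m \<odot> TO \<eta> j \<odot> FL D u" "cbot R = unitl X d \<odot> (r \<odot> TO \<eta> i)"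
      "left X R = tid X (FO D i)" "right X R = tid X d"
      by (simp_all add: L_def R_def)
    note [simp] = LR
    have \<kappa>mod: "(unitc X f \<star> K) \<bullet> TL (t r) u = TL (t n) u \<bullet> (\<kappa> \<star> cid X (TO \<eta> j) \<star> cid X (FL D u))"
      using modification.loose[OF cocone_map_cell_modification[OF r n \<kappa>] 4] s(4,5)
      by (simp add: cocone_map_cell_def id_modification_simps K_def)
    have "(unitc X f \<star> K) \<bullet> L = ((unitc X f \<star> K) \<bullet> (cid X (unitl X d) \<star> \<nu> i)) \<bullet> TL (t m) u"
      by (simp add: L_def)
    also have "\<dots> = (unitc X f \<star> \<mu> i) \<bullet> TL (t m) u"
      using hcomp_vcomp[of "\<nu> i" "cid X (unitl X d)" K "unitc X f"] \<kappa>\<nu>[OF s(4)] by (simp add: K_def)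
    also have "\<dots> = TL (t n) u \<bullet> (\<mu> j \<star> cid X (FL D u))"
      using modification.loose[OF \<mu> 4] by (simp add: id_modification_simps)
    also have "\<dots> = TL (t n) u \<bullet> ((\<kappa> \<star> cid X (TO \<eta> j) \<star> cid X (FL D u)) \<bullet> (\<nu> j \<star> cid X (FL D u)))"
      using hcomp_vcomp[of "cid X (FL D u)" "\<nu> j" "cid X (FL D u)" "\<kappa> \<star> cid X (TO \<eta> j)"] \<kappa>\<nu>[OF s(5)]
      by simp
    also have "\<dots> = ((unitc X f \<star> K) \<bullet> TL (t r) u) \<bullet> (\<nu> j \<star> cid X (FL D u))"
      unfolding \<kappa>mod by simp
    also have "\<dots> = (unitc X f \<star> K) \<bullet> R"
      by (simp add: R_def)
    finally have eq: "(unitc X f \<star> K) \<bullet> L = (unitc X f \<star> K) \<bullet> R" .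
    \<comment> \<open>The cell \<open>unitc f \<star> K\<close> is not itself of the form covered by \<open>cart\<close>, but the left unitor
      conjugates it to \<open>K\<close>, which is.\<close>
    have slide: "K \<bullet> (lunit X (r \<odot> TO \<eta> i) \<bullet> Z) = lunit X (n \<odot> TO \<eta> i) \<bullet> ((unitc X f \<star> K) \<bullet> Z)"
      if "arr Z" "cbot Z = unitl X d \<odot> (r \<odot> TO \<eta> i)" for Z
      using that lunit_nat[of K f]
        V.arr_simps(9)[of Z "lunit X (r \<odot> TO \<eta> i)" K, symmetric]
        V.arr_simps(9)[of Z "unitc X f \<star> K" "lunit X (n \<odot> TO \<eta> i)", symmetric]
      by (simp del: V.arr_simps(9))
    have "\<exists>!b. b \<in> cells X (m \<odot> TO \<eta> j \<odot> FL D u) (r \<odot> TO \<eta> i) (tid X (FO D i)) (tid X d)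
        \<and> K \<bullet> b = K \<bullet> (lunit X (r \<odot> TO \<eta> i) \<bullet> L)"
      unfolding K_def by (rule cart[OF cocone_component[OF s(4)]]) (auto intro!: cellsI)
    moreover have "lunit X (r \<odot> TO \<eta> i) \<bullet> L
        \<in> cells X (m \<odot> TO \<eta> j \<odot> FL D u) (r \<odot> TO \<eta> i) (tid X (FO D i)) (tid X d)"
      "lunit X (r \<odot> TO \<eta> i) \<bullet> R
        \<in> cells X (m \<odot> TO \<eta> j \<odot> FL D u) (r \<odot> TO \<eta> i) (tid X (FO D i)) (tid X d)"
      by (auto intro!: cellsI)
    moreover have "K \<bullet> (lunit X (r \<odot> TO \<eta> i) \<bullet> R) = K \<bullet> (lunit X (r \<odot> TO \<eta> i) \<bullet> L)"
      using slide[of L] slide[of R] eq by simp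
    ultimately have "lunit X (r \<odot> TO \<eta> i) \<bullet> L = lunit X (r \<odot> TO \<eta> i) \<bullet> R"
      by metis
    then have "L = R"
      by - (rule V.iso_cancel_left[of "lunit X (r \<odot> TO \<eta> i)"], simp_all)
    then show ?case
      by (simp add: L_def R_def id_modification_simps)
  qed
  with \<kappa>\<nu> show ?thesis by metis
qed

end

section \<open>From globular cells to cells with a tight boundary\<close>

text \<open>
  The assumption is the case of identity boundaries, for all targets \<open>r\<close>; it is applied to
  the restriction of \<open>n\<close> along \<open>f\<close>.  Cells and modifications with boundary \<open>f\<close> both correspond to
  their globular counterparts into that restriction, and \<open>t\<close> respects the correspondence.
\<close>

lemma loose_cocone_bij:
  assumes "equipment X" and "loose_cocone X I D c \<eta>"
    and ff: "\<And>r. r \<in> loose X c d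
      \<Longrightarrow> bij_betw (cocone_map_cell I X \<eta>) (cells X m r (tid X c) (tid X d))
        {\<mu>. modification I X (id_tight_trans X D) (const_tight_trans X (tid X d))
          (cocone_map I X D \<eta> m) (cocone_map I X D \<eta> r) \<mu>}"
    and m: "m \<in> loose X c d" and n: "n \<in> loose X c d'" and f: "f \<in> hom (Tight X) d d'"
  shows "bij_betw (cocone_map_cell I X \<eta>) (cells X m n (tid X c) f)
    {\<mu>. modification I X (id_tight_trans X D) (const_tight_trans X f)
      (cocone_map I X D \<eta> m) (cocone_map I X D \<eta> n) \<mu>}"
proof -
  interpret equipment X by fact
  interpret loose_cocone X I D c \<eta> by fact
  obtain r \<kappa> where r: "r \<in> loose X c d" and \<kappa>: "\<kappa> \<in> cells X r n (tid X c) f"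
    and ex: "\<And>a q g. a \<in> cells X q n g f \<Longrightarrow> \<exists>b \<in> cells X q r g (tid X d). \<kappa> \<bullet>\<^bsub>X\<^esub> b = a"
    and cart: "\<And>a p x q g. \<lbrakk>p \<in> loose X x c; a \<in> cells X q (n \<odot>\<^bsub>X\<^esub> p) g f\<rbrakk>
      \<Longrightarrow> \<exists>!b. b \<in> cells X q (r \<odot>\<^bsub>X\<^esub> p) g (tid X d) \<and> (\<kappa> \<star>\<^bsub>X\<^esub> cid X p) \<bullet>\<^bsub>X\<^esub> b = a"
    using restriction_stable[OF n f] by blast
  note ff = ff[OF r]
  have modi: "modification I X (id_tight_trans X D) (const_tight_trans X f) (t m) (t n) (t_cell a)"
    if "a \<in> cells X m n (tid X c) f" for a
    by (rule cocone_map_cell_modification[OF m n that])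
  have inj: "inj_on t_cell (cells X m n (tid X c) f)"
  proof (rule inj_onI)
    fix a a' assume a: "a \<in> cells X m n (tid X c) f" and a': "a' \<in> cells X m n (tid X c) f"
      and eq: "t_cell a = t_cell a'"
    obtain b b' where b: "b \<in> cells X m r (tid X c) (tid X d)" "\<kappa> \<bullet>\<^bsub>X\<^esub> b = a"
      and b': "b' \<in> cells X m r (tid X c) (tid X d)" "\<kappa> \<bullet>\<^bsub>X\<^esub> b' = a'"
      using ex[OF a] ex[OF a'] by blast
    have mods: "modification I X (id_tight_trans X D) (const_tight_trans X (tid X d)) (t m) (t r) (t_cell b)"
      "modification I X (id_tight_trans X D) (const_tight_trans X (tid X d)) (t m) (t r) (t_cell b')"
      using bij_betwE[OF ff] b(1) b'(1) by auto
    \<comment> \<open>Both are factorizations of the component of \<open>t_cell a\<close> through a cartesian cell.\<close>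
    have "t_cell b i = t_cell b' i" if i: "i \<in> Ob (Tight I)" for i
    proof -
      have "t_cell b i \<in> cells X (m \<odot>\<^bsub>X\<^esub> TO \<eta> i) (r \<odot>\<^bsub>X\<^esub> TO \<eta> i) (tid X (FO D i)) (tid X d)"
        "t_cell b' i \<in> cells X (m \<odot>\<^bsub>X\<^esub> TO \<eta> i) (r \<odot>\<^bsub>X\<^esub> TO \<eta> i) (tid X (FO D i)) (tid X d)"
        using modification.component[OF mods(1) i] modification.component[OF mods(2) i] i
        by (simp_all add: cocone_map_TO id_modification_simps const_functor_simps)
      moreover have "(\<kappa> \<star>\<^bsub>X\<^esub> cid X (TO \<eta> i)) \<bullet>\<^bsub>X\<^esub> t_cell b i = t_cell a i"
        "(\<kappa> \<star>\<^bsub>X\<^esub> cid X (TO \<eta> i)) \<bullet>\<^bsub>X\<^esub> t_cell b' i = t_cell a i"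
        using cocone_map_cell_vcomp[OF \<kappa> b(1) i] cocone_map_cell_vcomp[OF \<kappa> b'(1) i] b(2) b'(2) eq
        by simp_all
      moreover have "t_cell a i \<in> cells X (m \<odot>\<^bsub>X\<^esub> TO \<eta> i) (n \<odot>\<^bsub>X\<^esub> TO \<eta> i) (tid X (FO D i)) f"
        using modification.component[OF modi[OF a] i] i
        by (simp add: cocone_map_TO id_modification_simps)
      ultimately show ?thesis
        using cart[OF cocone_component[OF i]] by blast
    qed
    then have "t_cell b = t_cell b'"
      using modification.extensional[OF mods(1)] modification.extensional[OF mods(2)]
      by (intro extensionalityI[of _ "Ob (Tight I)"]) auto
    then have "b = b'"
      using ff b(1) b'(1) unfolding bij_betw_def by (auto dest: inj_onD)
    then show "a = a'" using b(2) b'(2) by simp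
  qed
  have "\<exists>a \<in> cells X m n (tid X c) f. t_cell a = \<mu>"
    if \<mu>: "modification I X (id_tight_trans X D) (const_tight_trans X f) (t m) (t n) \<mu>" for \<mu>
  proof -
    have "\<exists>\<nu>. modification I X (id_tight_trans X D) (const_tight_trans X (tid X d)) (t m) (t r) \<nu>
        \<and> (\<forall>i \<in> Ob (Tight I). \<mu> i = (\<kappa> \<star>\<^bsub>X\<^esub> cid X (TO \<eta> i)) \<bullet>\<^bsub>X\<^esub> \<nu> i)"
      by (rule modification_factors[OF m n r f \<kappa> _ \<mu>]) (rule cart)
    then obtain \<nu> where \<nu>: "modification I X (id_tight_trans X D) (const_tight_trans X (tid X d)) (t m) (t r) \<nu>"
      and \<mu>\<nu>: "\<And>i. i \<in> Ob (Tight I) \<Longrightarrow> \<mu> i = (\<kappa> \<star>\<^bsub>X\<^esub> cid X (TO \<eta> i)) \<bullet>\<^bsub>X\<^esub> \<nu> i"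
      by blast
    obtain b where b: "b \<in> cells X m r (tid X c) (tid X d)" and "t_cell b = \<nu>"
      using ff \<nu> unfolding bij_betw_def by (metis (mono_tags, lifting) imageE mem_Collect_eq)
    have d: "c \<in> Ob (Tight X)" "d \<in> Ob (Tight X)" "f \<in> Ar (Tight X)" "Dom (Tight X) f = d"
      using m f loose_simps(1,2)[of m] by (auto simp: loose_def hom_def)
    have a: "\<kappa> \<bullet>\<^bsub>X\<^esub> b \<in> cells X m n (tid X c) f"
      using cellsD[OF \<kappa>] cellsD[OF b] d by (auto intro!: cellsI simp: typing T.arr_simps)
    have "t_cell (\<kappa> \<bullet>\<^bsub>X\<^esub> b) i = \<mu> i" if "i \<in> Ob (Tight I)" for i
      using cocone_map_cell_vcomp[OF \<kappa> b that] \<mu>\<nu>[OF that] \<open>t_cell b = \<nu>\<close> by simp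
    then have "t_cell (\<kappa> \<bullet>\<^bsub>X\<^esub> b) = \<mu>"
      using modification.extensional[OF modi[OF a]] modification.extensional[OF \<mu>]
      by (intro extensionalityI[of _ "Ob (Tight I)"]) auto
    with a show ?thesis by blast
  qed
  then have "{\<mu>. modification I X (id_tight_trans X D) (const_tight_trans X f) (t m) (t n) \<mu>}
      \<subseteq> t_cell ` cells X m n (tid X c) f"
    by blast
  moreover have "t_cell ` cells X m n (tid X c) f
      \<subseteq> {\<mu>. modification I X (id_tight_trans X D) (const_tight_trans X f) (t m) (t n) \<mu>}"
    using modi by blast
  ultimately show ?thesis using inj unfolding bij_betw_def by blast
qed

section \<open>The underlying bicategory\<close>

context pseudo_double_category
begin

abbreviation UB where "UB \<equiv> underlying_bicategory X"

lemma underlying_simps [simp]: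
  "Ob (Tight UB) = Ob (Tight X)" "Ar (Tight UB) = tid X ` Ob (Tight X)"
  "Dom (Tight UB) = Dom (Tight X)" "Cod (Tight UB) = Cod (Tight X)"
  "ide (Tight UB) = ide (Tight X)" "Comp (Tight UB) = Comp (Tight X)"
  "Ob (Cells UB) = Ob (Cells X)" "Dom (Cells UB) = Dom (Cells X)" "Cod (Cells UB) = Cod (Cells X)"
  "ide (Cells UB) = ide (Cells X)" "Comp (Cells UB) = Comp (Cells X)"
  "Ar (Cells UB) = {a. arr a \<and> left X a \<in> tid X ` Ob (Tight X) \<and> right X a \<in> tid X ` Ob (Tight X)}"
  "lsrc UB = lsrc X" "ltgt UB = ltgt X" "left UB = left X" "right UB = right X"
  "unitl UB = unitl X" "unitc UB = unitc X" "lcomp UB = lcomp X" "hcomp UB = hcomp X"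
  "assoc UB = assoc X" "lunit UB = lunit X" "runit UB = runit X"
  by (auto simp: underlying_bicategory_def)

lemma underlying_loose [simp]: "loose UB = loose X"
  by (simp add: loose_def fun_eq_iff)

lemma underlying_cells:
  "\<lbrakk>f \<in> tid X ` Ob (Tight X); g \<in> tid X ` Ob (Tight X)\<rbrakk> \<Longrightarrow> cells UB m n f g = cells X m n f g"
  by (auto simp: cells_def hom_def)

lemma underlying_globular: "m \<in> Ob (Cells X) \<Longrightarrow> globular UB m n = globular X m n"
  by (simp add: globular_def underlying_cells loose_simps)

lemma underlying_hom_cat:
  "\<lbrakk>x \<in> Ob (Tight X); y \<in> Ob (Tight X)\<rbrakk> \<Longrightarrow> loose_hom_cat UB x y = loose_hom_cat X x y"
  by (auto simp: loose_hom_cat_def)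

text \<open>
  An inverse is the same in the equipment and in the underlying bicategory provided it is
  globular, which it is for a globular cell.  Globularity matters, as the underlying bicategory
  retains only the cells with identities on both sides.
\<close>

lemma underlying_inverse:
  assumes a: "a \<in> globular X m n" and m: "m \<in> Ob (Cells X)"
  shows "iso_in (Cells UB) a \<longleftrightarrow> iso_in (Cells X) a" and "inv_in (Cells UB) a = inv_in (Cells X) a"
proof -
  note a' = cellsD[OF a[unfolded globular_def]]
  have "inverse_in (Cells UB) a = inverse_in (Cells X) a"
  proof (rule ext, rule iffI)
    fix g assume "inverse_in (Cells UB) a g"
    then show "inverse_in (Cells X) a g" by (auto simp: inverse_in_def hom_def)
  next
    fix g assume g: "inverse_in (Cells X) a g"
    then have i: "iso_in (Cells X) a" and g': "g = inv_in (Cells X) a"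
      using V.inv_in_eqI unfolding iso_in_def by auto
    have "left X g = tid X (lsrc X m)" "right X g = tid X (ltgt X m)"
      unfolding g' using a' by (auto intro!: inv_boundary[OF i])
    then show "inverse_in (Cells UB) a g"
      using g a' m by (auto simp: inverse_in_def hom_def loose_simps)
  qed
  then show "iso_in (Cells UB) a \<longleftrightarrow> iso_in (Cells X) a" "inv_in (Cells UB) a = inv_in (Cells X) a"
    by (simp_all add: iso_in_def inv_in_def)
qed

lemma underlying_ainv:
  assumes "m \<in> loose X w x" "n \<in> loose X x y" "p \<in> loose X y z"
  shows "inv_in (Cells UB) (assoc X p n m) = ainv p n m"
  using assoc_iso[OF assms] lcomp_loose[OF assms(1) lcomp_loose[OF assms(2,3)]]
  by (intro underlying_inverse(2)) (auto simp: loose_def)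

lemma underlying_linv:
  assumes "m \<in> loose X x y"
  shows "inv_in (Cells UB) (lunit X m) = linv m"
proof (rule underlying_inverse(2))
  show "lunit X m \<in> globular X (unitl X y \<odot> m) m" using lunit_iso[OF assms] by simp
  show "loose_arr (unitl X y \<odot> m)"
    using assms loose_simps(2)[of m] by (auto simp: loose_def typing)
qed

lemma underlying_const_functor: "const_functor UB d = const_functor X d"
  by (simp add: const_functor_def)

text \<open>
  The diagonal preserves identities.  This lets the globular modifications of the bicategorical
  statement be read as the case \<open>f = 1\<close> of the modifications in the loose one.
\<close>

lemma id_tight_trans_const:
  "d \<in> Ob (Tight X) \<Longrightarrow> id_tight_trans X (const_functor X d) = const_tight_trans X (tid X d)"
  by (simp add: const_tight_trans_def id_tight_trans_def const_functor_def unitc_tid)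

lemma underlying_id_tight_trans: "id_tight_trans UB F = id_tight_trans X F"
  by (simp add: id_tight_trans_def)

lemma underlying_lax:
  assumes "lax_double_functor I UB F"
  shows "lax_double_functor I X F"
proof -
  interpret F: lax_double_functor I UB F by fact
  have sub: "f \<in> hom (Tight UB) x y \<Longrightarrow> f \<in> hom (Tight X) x y"
    "a \<in> hom (Cells UB) m n \<Longrightarrow> a \<in> hom (Cells X) m n" for f x y a m n
    by (auto simp: hom_def T.arr_simps)
  have glob: "a \<in> globular UB m n \<Longrightarrow> a \<in> globular X m n" for a m n
    using sub(2) by (auto simp: globular_def cells_def)
  show ?thesis
  proof (rule lax_double_functor.intro, goal_cases)
    case 1
    then show ?case using F.tight_functor sub(1) by (simp add: cat_functor_def)
  next
    case 2
    then show ?case using F.cells_functor sub(2) by (simp add: cat_functor_def)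
  next
    case 3 then show ?case using F.loose by simp
  next
    case 4 then show ?case using F.boundary by simp
  next
    case 5 then show ?case using glob[OF F.Fcomp_cell] by simp
  next
    case 6 then show ?case using F.Fcomp_natural by simp
  next
    case 7 then show ?case using glob[OF F.Funit_cell] by simp
  next
    case 8 then show ?case using F.Funit_natural by simp
  next
    case 9 then show ?case using F.Fcomp_assoc by simp
  next
    case 10 then show ?case using F.Fcomp_lunit by simp
  next
    case 11 then show ?case using F.Fcomp_runit by simp
  qed
qed

text \<open>
  The two notions differ only in the inverses of structure cells and in the condition that
  tight components are globular, which is automatic because \<open>F\<close> and \<open>G\<close> send tight arrows to
  identities.
\<close>

lemma underlying_trans_iff:
  assumes I: "bicategory I"
    and F: "\<And>u i j. u \<in> loose I i j \<Longrightarrow> FL F u \<in> loose X (FO F i) (FO F j)"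
    and G: "\<And>u i j. u \<in> loose I i j \<Longrightarrow> FL G u \<in> loose X (FO G i) (FO G j)"
    and FT: "\<And>f. f \<in> Ar (Tight I) \<Longrightarrow> FT F f \<in> tid X ` Ob (Tight X)"
    and GT: "\<And>f. f \<in> Ar (Tight I) \<Longrightarrow> FT G f \<in> tid X ` Ob (Tight X)"
  shows "pseudo_loose_trans I UB F G \<sigma> \<longleftrightarrow> pseudo_loose_trans I X F G \<sigma>"
proof -
  interpret I: bicategory I by fact
  have ob: "i \<in> Ob (Tight I)" "j \<in> Ob (Tight I)" if "u \<in> loose I i j" for u i j
    using that I.loose_simps(1,2) by (auto simp: loose_def)
  have glob: "globular UB (TO \<sigma> j \<odot> FL F u) (FL G u \<odot> TO \<sigma> i) = globular X (TO \<sigma> j \<odot> FL F u) (FL G u \<odot> TO \<sigma> i)"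
    if "u \<in> loose I i j" "TO \<sigma> j \<in> loose X (FO F j) (FO G j)" for u i j
    using lcomp_loose[OF F[OF that(1)] that(2)] by (intro underlying_globular) (auto simp: loose_def)
  have iso: "iso_in (Cells UB) (TL \<sigma> u) = iso_in (Cells X) (TL \<sigma> u)"
    if "u \<in> loose I i j" "TO \<sigma> j \<in> loose X (FO F j) (FO G j)"
      "TL \<sigma> u \<in> globular X (TO \<sigma> j \<odot> FL F u) (FL G u \<odot> TO \<sigma> i)" for u i j
    using lcomp_loose[OF F[OF that(1)] that(2)] by (intro underlying_inverse[OF that(3)]) (auto simp: loose_def)
  show ?thesis
  proof
    assume "pseudo_loose_trans I UB F G \<sigma>"
    then interpret s: pseudo_loose_trans I UB F G \<sigma> .
    have c: "TO \<sigma> i \<in> loose X (FO F i) (FO G i)" if "i \<in> Ob (Tight I)" for i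
      using s.component[OF that] by simp
    have l: "TL \<sigma> u \<in> globular X (TO \<sigma> j \<odot> FL F u) (FL G u \<odot> TO \<sigma> i)"
      "iso_in (Cells X) (TL \<sigma> u)" if u: "u \<in> loose I i j" for u i j
      using s.component_loose[OF u] glob[OF u c[OF ob(2)[OF u]]] iso[OF u c[OF ob(2)[OF u]]] by auto
    show "pseudo_loose_trans I X F G \<sigma>"
    proof (rule pseudo_loose_trans.intro, goal_cases)
      case 4 then show ?case
        using s.tight_functor by (auto simp: cat_functor_def hom_def)
    next
      case (9 u i j v k)
      note o = ob[OF 9(1)] ob[OF 9(2)]
      show ?case
        using s.comp[OF 9] underlying_ainv[OF c[OF o(1)] G[OF 9(1)] G[OF 9(2)]]
          underlying_ainv[OF F[OF 9(1)] F[OF 9(2)] c[OF o(4)]] by simp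
    next
      case (10 i)
      then show ?case using s.unit[OF 10] underlying_linv[OF c[OF 10]] by simp
    qed (use s.extensional c s.component_tight l s.natural_cells in auto)
  next
    assume "pseudo_loose_trans I X F G \<sigma>"
    then interpret s: pseudo_loose_trans I X F G \<sigma> .
    have l: "TL \<sigma> u \<in> globular UB (TO \<sigma> j \<odot> FL F u) (FL G u \<odot> TO \<sigma> i)"
      "iso_in (Cells UB) (TL \<sigma> u)" if u: "u \<in> loose I i j" for u i j
      using s.component_loose[OF u] glob[OF u s.component[OF ob(2)[OF u]]]
        iso[OF u s.component[OF ob(2)[OF u]]] by auto
    show "pseudo_loose_trans I UB F G \<sigma>"
    proof (rule pseudo_loose_trans.intro, goal_cases)
      case 4
      have "TT \<sigma> f \<in> hom (Cells UB) (TO \<sigma> i) (TO \<sigma> j)" if "f \<in> hom (Tight I) i j" for f i j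
        using cat_functor.ar[OF s.tight_functor that] s.component_tight[of f] FT[of f] GT[of f] that
        by (auto simp: hom_def)
      then show ?case
        using s.tight_functor by (simp add: cat_functor_def)
    next
      case (9 u i j v k)
      note o = ob[OF 9(1)] ob[OF 9(2)]
      show ?case
        using s.comp[OF 9] underlying_ainv[OF s.component[OF o(1)] G[OF 9(1)] G[OF 9(2)]]
          underlying_ainv[OF F[OF 9(1)] F[OF 9(2)] s.component[OF o(4)]] by simp
    next
      case (10 i)
      then show ?case using s.unit[OF 10] underlying_linv[OF s.component[OF 10]] by simp
    qed (use s.extensional s.component s.component_tight l s.natural_cells in auto)
  qed
qed

lemma underlying_modification:
  assumes "\<And>i. i \<in> Ob (Tight I) \<Longrightarrow> FO F i \<in> Ob (Tight X)"
    and "\<And>i. i \<in> Ob (Tight I) \<Longrightarrow> FO G i \<in> Ob (Tight X)"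
  shows "modification I UB (id_tight_trans X F) (id_tight_trans X G) \<sigma> \<tau> \<mu>
    \<longleftrightarrow> modification I X (id_tight_trans X F) (id_tight_trans X G) \<sigma> \<tau> \<mu>"
  using assms by (auto simp: modification_def id_modification_simps underlying_cells)

lemma loose_hom_cat_category:
  assumes "x \<in> Ob (Tight X)" "y \<in> Ob (Tight X)"
  shows "category (loose_hom_cat X x y)"
    and "\<lbrakk>m \<in> loose X x y; n \<in> loose X x y\<rbrakk>
      \<Longrightarrow> hom (loose_hom_cat X x y) m n = cells X m n (tid X x) (tid X y)"
proof -
  note [simp] = typing T.arr_simps assms
  have boundary: "lsrc X (ctop a) = x \<and> ltgt X (ctop a) = y \<and> lsrc X (cbot a) = x \<and> ltgt X (cbot a) = y"
    if "arr a" "left X a = tid X x" "right X a = tid X y" for a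
    using that cell_simps(5-8)[OF that(1)] by simp
  show "category (loose_hom_cat X x y)"
    by unfold_locales (auto simp: loose_hom_cat_def hom_def loose_def boundary)
  show "\<lbrakk>m \<in> loose X x y; n \<in> loose X x y\<rbrakk>
      \<Longrightarrow> hom (loose_hom_cat X x y) m n = cells X m n (tid X x) (tid X y)"
    by (auto simp: loose_hom_cat_def cells_def hom_def)
qed

end

lemma (in loose_cocone) underlying_cocone_map:
  assumes m: "m \<in> loose X c d"
  shows "cocone_map I UB D \<eta> m = cocone_map I X D \<eta> m"
proof -
  have const: "const_loose_trans I UB m = const_loose_trans I X m"
    using underlying_linv[OF m] by (simp add: const_loose_trans_def)
  have d: "c \<in> Ob (Tight X)" and l: "lsrc X m = c" "ltgt X m = d"
    using m loose_simps(1)[of m] by (auto simp: loose_def)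
  have "inv_in (Cells UB) (assoc X (TO (const_loose_trans I X m) (ltgt I u)) (unitl X c) (TO \<eta> (lsrc I u)))
      = ainv (TO (const_loose_trans I X m) (ltgt I u)) (unitl X c) (TO \<eta> (lsrc I u))"
    if "u \<in> Ob (Cells I)" for u
    using underlying_ainv[OF cocone_component unitl_loose[OF d] m] I.loose_simps(1,2)[OF that]
    by (simp add: const_loose_trans_def)
  then show ?thesis
    unfolding cocone_map_def trans_comp_def
    by (simp add: underlying_const_functor const l const_functor_simps Let_def cong: restrict_cong)
qed

section \<open>Bicategorical colimits are loose colimits\<close>

theorem lemma5p10:
  fixes \<I> :: "('io, 'it, 'il, 'ic) dblcat"
    and \<D> :: "('o, 't, 'l, 'c) dblcat"
    and D :: "('io, 'it, 'il, 'ic, 'o, 't, 'l, 'c) dblfunctor"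
    and c :: 'o
    and \<eta> :: "('io, 'it, 'il, 'l, 'c) loose_trans"
  assumes "bicategory \<I>"
    and "equipment \<D>"
    and "lax_double_functor \<I> (underlying_bicategory \<D>) D"
    and "bicategorical_colimit_cocone \<I> (underlying_bicategory \<D>) D c \<eta>"
  shows "lax_double_functor \<I> \<D> D \<and> loose_colimit_cocone \<I> \<D> D c \<eta>"
proof -
  interpret I: bicategory \<I> by fact
  interpret X: equipment \<D> by fact
  let ?B = "underlying_bicategory \<D>"
  have D: "lax_double_functor \<I> \<D> D" by (rule X.underlying_lax[OF assms(3)])
  interpret D: lax_double_functor \<I> \<D> D by fact
  have c: "c \<in> Ob (Tight \<D>)"
    and \<eta>UB: "pseudo_loose_trans \<I> ?B D (const_functor \<D> c) \<eta>"
    and eqv: "\<And>d. d \<in> Ob (Tight \<D>) \<Longrightarrow>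
       equivalence_of_categories (loose_hom_cat ?B c d) (trans_cat \<I> ?B D (const_functor \<D> d))
         (cocone_map \<I> ?B D \<eta>)
         (\<lambda>a. (cocone_map \<I> ?B D \<eta> (Dom (Cells \<D>) a), cocone_map_cell \<I> ?B \<eta> a,
               cocone_map \<I> ?B D \<eta> (Cod (Cells \<D>) a)))"
    using assms(4) unfolding bicategorical_colimit_cocone_def by (simp_all add: X.underlying_const_functor)
  have DO: "FO D i \<in> Ob (Tight \<D>)" if "i \<in> Ob (Tight \<I>)" for i
    using cat_functor.ob[OF D.tight_functor that] .
  have DT: "FT D f \<in> tid \<D> ` Ob (Tight \<D>)" if "f \<in> Ar (Tight \<I>)" for f
    using cat_functor.ar[OF lax_double_functor.tight_functor[OF assms(3)], of f] that
    by (simp add: hom_def)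
  have const: "FL (const_functor \<D> d) u \<in> loose \<D> (FO (const_functor \<D> d) i) (FO (const_functor \<D> d) j)"
    if "d \<in> Ob (Tight \<D>)" for d and u :: 'il and i j :: 'io
    using X.unitl_loose[OF that] by (simp add: X.const_functor_simps)
  have trans: "pseudo_loose_trans \<I> ?B D (const_functor \<D> d) \<sigma>
      \<longleftrightarrow> pseudo_loose_trans \<I> \<D> D (const_functor \<D> d) \<sigma>" if "d \<in> Ob (Tight \<D>)" for d \<sigma>
    using X.underlying_trans_iff[OF assms(1) D.loose const[OF that] DT] that
    by (simp add: X.const_functor_simps)
  have trans_cat: "trans_cat \<I> ?B D (const_functor \<D> d) = trans_cat \<I> \<D> D (const_functor \<D> d)"
    if "d \<in> Ob (Tight \<D>)" for d
    using that DO
    by (simp add: trans_cat_def trans X.underlying_id_tight_trans X.underlying_modification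
        X.const_functor_simps)
  have \<eta>: "pseudo_loose_trans \<I> \<D> D (const_functor \<D> c) \<eta>" using \<eta>UB trans[OF c] by simp
  have lc: "loose_cocone \<D> \<I> D c \<eta>"
    unfolding loose_cocone_def loose_cocone_axioms_def
    using X.pseudo_double_category_axioms assms(1) D \<eta> by blast
  interpret loose_cocone \<D> \<I> D c \<eta> by (rule lc)
  have tcB: "cocone_map_cell \<I> ?B \<eta> = cocone_map_cell \<I> \<D> \<eta>"
    by (simp add: cocone_map_cell_def fun_eq_iff)
  define Fa where "Fa = (\<lambda>a. (cocone_map \<I> ?B D \<eta> (Dom (Cells \<D>) a), cocone_map_cell \<I> \<D> \<eta> a,
               cocone_map \<I> ?B D \<eta> (Cod (Cells \<D>) a)))"
  have equiv: "equivalence_of_categories (loose_hom_cat \<D> c d) (trans_cat \<I> \<D> D (const_functor \<D> d))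
      (cocone_map \<I> ?B D \<eta>) Fa" if "d \<in> Ob (Tight \<D>)" for d
    using eqv[OF that] X.underlying_hom_cat[OF c that] trans_cat[OF that] by (simp add: Fa_def tcB)
  have surj: "\<exists>m \<in> loose \<D> c d. isomorphic_in (trans_cat \<I> \<D> D (const_functor \<D> d)) \<sigma> (t m)"
    if d: "d \<in> Ob (Tight \<D>)" and \<sigma>: "pseudo_loose_trans \<I> \<D> D (const_functor \<D> d) \<sigma>" for d \<sigma>
    using equivalence_ess_surj[OF equiv[OF d], of \<sigma>] \<sigma> underlying_cocone_map
    by (auto simp: trans_cat_def loose_hom_cat_def)
  have ff: "bij_betw t_cell (cells \<D> m r (tid \<D> c) (tid \<D> d))
      {\<mu>. modification \<I> \<D> (id_tight_trans \<D> D) (const_tight_trans \<D> (tid \<D> d)) (t m) (t r) \<mu>}"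
    (is "bij_betw _ ?C ?M")
    if d: "d \<in> Ob (Tight \<D>)" and m: "m \<in> loose \<D> c d" and r: "r \<in> loose \<D> c d" for d m r
  proof -
    let ?T = "trans_cat \<I> \<D> D (const_functor \<D> d)"
    have mr: "m \<in> Ob (loose_hom_cat \<D> c d)" "r \<in> Ob (loose_hom_cat \<D> c d)"
      using m r by (simp_all add: loose_hom_cat_def)
    have "bij_betw Fa (hom (loose_hom_cat \<D> c d) m r)
        (hom ?T (cocone_map \<I> ?B D \<eta> m) (cocone_map \<I> ?B D \<eta> r))"
      using equivalence_fully_faithful[OF X.loose_hom_cat_category(1)[OF c d] 
          X.trans_cat_category[OF I.pseudo_double_category_axioms D.loose const[OF d]] equiv[OF d] mr] .
    then have 1: "bij_betw Fa ?C (hom ?T (t m) (t r))"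
      by (simp add: X.loose_hom_cat_category(2)[OF c d m r] underlying_cocone_map[OF m] underlying_cocone_map[OF r])
    have "cat_functor (loose_hom_cat \<D> c d) ?T (cocone_map \<I> ?B D \<eta>) Fa"
      using equiv[OF d] unfolding equivalence_of_categories_def by blast
    from cat_functor.ob[OF this mr(1)] cat_functor.ob[OF this mr(2)]
    have "pseudo_loose_trans \<I> \<D> D (const_functor \<D> d) (t m)"
      "pseudo_loose_trans \<I> \<D> D (const_functor \<D> d) (t r)"
      by (simp_all add: trans_cat_def underlying_cocone_map[OF m] underlying_cocone_map[OF r])
    then have 2: "bij_betw (fst \<circ> snd) (hom ?T (t m) (t r)) ?M"
      by (intro bij_betw_byWitness[where f' = "\<lambda>\<mu>. (t m, \<mu>, t r)"]) (auto simp: trans_cat_def hom_def X.id_tight_trans_const[OF d])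
    from bij_betw_trans[OF 1 2] show ?thesis
      by (simp add: Fa_def comp_def)
  qed
  have "bij_betw t_cell (cells \<D> m n (tid \<D> c) f)
      {\<mu>. modification \<I> \<D> (id_tight_trans \<D> D) (const_tight_trans \<D> f) (t m) (t n) \<mu>}"
    if "d \<in> Ob (Tight \<D>)" "m \<in> loose \<D> c d" "n \<in> loose \<D> c d'" "f \<in> hom (Tight \<D>) d d'" for d d' m n f
    using loose_cocone_bij[OF assms(2) lc ff[OF that(1,2)] that(2-4)] .
  with D c \<eta> surj show ?thesis
    unfolding loose_colimit_cocone_def by blast
qed

end
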